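(* The compact 2-step nilmanifold $N^j$ is a naturally reductive Riemannian manifold.
   Context: Construction of $N^j$: let $\mathbb H^*=\mathrm{Span}\{\mathbf i,\mathbf j,\mathbf k\}$ be the pure quaternions. Take $\mathfrak v=\mathbb H^*\oplus\mathbb H^*\cong\mathbb R^6$ with orthonormal basis $\{X_{\mathbf i},X_{\mathbf j},X_{\mathbf k},Y_{\mathbf i},Y_{\mathbf j},Y_{\mathbf k}\}$ (standard bases of first and second summand) and $\mathfrak z=\mathbb H^*\cong\mathbb R^3$ with orthonormal basis $\{Z_{\mathbf i},Z_{\mathbf j},Z_{\mathbf k}\}$, and let $\mathfrak n=\mathfrak v\oplus\mathfrak z$ be the orthogonal direct sum with inner product $g$. For $C\in\mathfrak z$ and $(L,R)\in\mathfrak v$ set $j_C(L,R)=(\mathrm{Im}(C\cdot L),\mathrm{Im}(C\cdot R))$, with quaternion multiplication and $\mathrm{Im}$ the imaginary part; then $j_C\in\mathfrak{so}(\mathfrak v)$. Let $\mathfrak n(j)$ be $\mathfrak n$ with the 2-step nilpotent Lie bracket determined by $[\mathfrak n,\mathfrak z]=0$, $[\mathfrak v,\mathfrak v]\subseteq\mathfrak z$, $g([V,W],Z)=g(j_ZV,W)$ for $V,W\in\mathfrak v$, $Z\in\mathfrak z$; let $N(j)$ be the simply connected Lie group with Lie algebra $\mathfrak n(j)$ and the left-invariant metric induced by $g$. Let $\mathcal R=\mathrm{Span}_{\mathbb Z}\{X_{\mathbf i},X_{\mathbf j},X_{\mathbf k},Y_{\mathbf i},Y_{\mathbf j},Y_{\mathbf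 k},\tfrac12Z_{\mathbf i},\tfrac12Z_{\mathbf j},\tfrac12Z_{\mathbf k}\}$ and $\Gamma(j)=\exp(\mathcal R)$, a cocompact discrete subgroup of $N(j)$. Then $N^j=\Gamma(j)\backslash N(j)$ with the induced metric (the projection is a Riemannian covering). For a Riemannian manifold $(M,g)$ let $\nabla$ be the Levi-Civita connection and $R(X,Y)=[\nabla_X,\nabla_Y]-\nabla_{[X,Y]}$. A homogeneous structure on $(M,g)$ is a $(2,1)$-tensor field $T$, $(X,Y)\mapsto T_XY$, such that for all vector fields $V,X,Y,Z$: (1) $(\nabla_V R)(X,Y)Z=T_V(R(X,Y)Z)-R(T_VX,Y)Z-R(X,T_VY)Z-R(X,Y)(T_VZ)$; (2) $(\nabla_XT)_Y=[T_X,T_Y]-T_{T_XY}$; (3) $g(T_XY,Z)+g(Y,T_XZ)=0$. $(M,g)$ is naturally reductive if it admits a homogeneous structure $T$ with $T_XX=0$ for every vector field $X$. *)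

theory Defs
  imports
    "HOL-Analysis.Analysis"
    "HOL-Library.Function_Algebras"
    "HOL-Algebra.Coset"
begin

section \<open>Smooth manifolds and vector fields\<close>

text \<open>Maps of class \<open>C\<^sup>k\<close> and \<open>C\<^sup>\<infinity>\<close>; the set \<^term>\<open>S\<close> is always meant to be open.\<close>

primrec C_k_on :: "nat \<Rightarrow> 'a set \<Rightarrow> ('a::euclidean_space \<Rightarrow> 'b::real_normed_vector) \<Rightarrow> bool" where
  "C_k_on 0 S f \<longleftrightarrow> continuous_on S f"
| "C_k_on (Suc k) S f \<longleftrightarrow> (\<forall>x\<in>S. f differentiable (at x)) \<and>
     (\<forall>\<xi>. C_k_on k S (\<lambda>x. frechet_derivative f (at x) \<xi>))"

definition smooth_on :: "'a set \<Rightarrow> ('a::euclidean_space \<Rightarrow> 'b::real_normed_vector) \<Rightarrow> bool" where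
  "smooth_on S f \<longleftrightarrow> (\<forall>k. C_k_on k S f)"

text \<open>The points of a manifold are the elements of a type. A chart is a pair of its domain and
  its coordinate map; the values of the coordinate map outside the domain carry no information.\<close>

type_synonym ('m, 'e) chart = "'m set \<times> ('m \<Rightarrow> 'e)"

definition is_chart :: "('m::topological_space, 'e::euclidean_space) chart \<Rightarrow> bool" where
  "is_chart c \<longleftrightarrow> (case c of (U, \<phi>) \<Rightarrow>
     open U \<and> open (\<phi> ` U) \<and> homeomorphism U (\<phi> ` U) \<phi> (inv_into U \<phi>))"

definition smooth_manifold :: "('m::topological_space, 'e::euclidean_space) chart set \<Rightarrow> bool" where
  "smooth_manifold A \<longleftrightarrow>
     Hausdorff_space (euclidean :: 'm topology) \<and>
     second_countable (euclidean :: 'm topology) \<and>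
     (\<forall>c\<in>A. is_chart c) \<and> (\<Union>(U, \<phi>)\<in>A. U) = UNIV \<and>
     (\<forall>(U, \<phi>)\<in>A. \<forall>(V, \<psi>)\<in>A. smooth_on (\<phi> ` (U \<inter> V)) (\<psi> \<circ> inv_into U \<phi>))"

definition smooth_fun_on ::
  "('m::topological_space, 'e::euclidean_space) chart set \<Rightarrow> 'm set \<Rightarrow> ('m \<Rightarrow> real) \<Rightarrow> bool" where
  "smooth_fun_on A W f \<longleftrightarrow> (\<forall>(U, \<phi>)\<in>A. smooth_on (\<phi> ` (U \<inter> W)) (f \<circ> inv_into U \<phi>))"

definition smooth_near ::
  "('m::topological_space, 'e::euclidean_space) chart set \<Rightarrow> 'm \<Rightarrow> ('m \<Rightarrow> real) \<Rightarrow> bool" where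
  "smooth_near A p f \<longleftrightarrow> (\<exists>W. open W \<and> p \<in> W \<and> smooth_fun_on A W f)"

text \<open>A tangent vector at \<open>p\<close> is represented by its action on the functions that are smooth near \<open>p\<close>:
  in a chart \<open>\<phi>\<close> it is a directional derivative, \<open>f \<mapsto> D(f \<circ> \<phi>\<^sup>-\<^sup>1)(\<phi> p) \<xi>\<close>.
  The value on the remaining functions is fixed to be \<open>0\<close>, so that equal tangent vectors are equal
  as functions.\<close>

type_synonym 'm tangent = "('m \<Rightarrow> real) \<Rightarrow> real"

definition coord_vector ::
  "('m::topological_space, 'e::euclidean_space) chart set \<Rightarrow> ('m, 'e) chart \<Rightarrow> 'm \<Rightarrow> 'e \<Rightarrow> 'm tangent" where
  "coord_vector A c p \<xi> = (case c of (U, \<phi>) \<Rightarrow>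
     \<lambda>f. if smooth_near A p f then frechet_derivative (f \<circ> inv_into U \<phi>) (at (\<phi> p)) \<xi> else 0)"

definition tangent_space ::
  "('m::topological_space, 'e::euclidean_space) chart set \<Rightarrow> 'm \<Rightarrow> 'm tangent set" where
  "tangent_space A p = {coord_vector A (U, \<phi>) p \<xi> | U \<phi> \<xi>. (U, \<phi>) \<in> A \<and> p \<in> U}"

text \<open>The differential at \<open>p\<close> of a smooth map \<open>F\<close> into the manifold with atlas \<open>B\<close>.\<close>

definition differential ::
  "('n::topological_space, 'e::euclidean_space) chart set \<Rightarrow> ('m \<Rightarrow> 'n) \<Rightarrow> 'm \<Rightarrow> 'm tangent \<Rightarrow> 'n tangent" where
  "differential B F p u = (\<lambda>h. if smooth_near B (F p) h then u (h \<circ> F) else 0)"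

type_synonym 'm vfield = "'m \<Rightarrow> 'm tangent"

definition vector_fields ::
  "('m::topological_space, 'e::euclidean_space) chart set \<Rightarrow> 'm vfield set" where
  "vector_fields A = {X. (\<forall>p. X p \<in> tangent_space A p) \<and>
     (\<forall>W f. open W \<longrightarrow> smooth_fun_on A W f \<longrightarrow> smooth_fun_on A W (\<lambda>p. X p f))}"

definition fun_scale :: "('m \<Rightarrow> real) \<Rightarrow> 'm vfield \<Rightarrow> 'm vfield" where
  "fun_scale h X = (\<lambda>p f. h p * X p f)"

definition lie_bracket ::
  "('m::topological_space, 'e::euclidean_space) chart set \<Rightarrow> 'm vfield \<Rightarrow> 'm vfield \<Rightarrow> 'm vfield" where
  "lie_bracket A X Y =
     (\<lambda>p f. if smooth_near A p f then X p (\<lambda>q. Y q f) - Y p (\<lambda>q. X q f) else 0)"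


section \<open>Riemannian manifolds, homogeneous structures, natural reductivity\<close>

text \<open>Sums and differences of tangent vectors and of vector fields are those of functions.\<close>

type_synonym 'm metric_tensor = "'m \<Rightarrow> 'm tangent \<Rightarrow> 'm tangent \<Rightarrow> real"

definition riemannian_manifold ::
  "('m::topological_space, 'e::euclidean_space) chart set \<Rightarrow> 'm metric_tensor \<Rightarrow> bool" where
  "riemannian_manifold A g \<longleftrightarrow> smooth_manifold A \<and>
     (\<forall>p. \<forall>u\<in>tangent_space A p. \<forall>v\<in>tangent_space A p.
        g p u v = g p v u \<and> (u \<noteq> 0 \<longrightarrow> 0 < g p u u) \<and>
        (\<forall>w\<in>tangent_space A p. \<forall>a b. g p (\<lambda>f. a * u f + b * v f) w = a * g p u w + b * g p v w)) \<and>
     (\<forall>X\<in>vector_fields A. \<forall>Y\<in>vector_fields A. smooth_fun_on A UNIV (\<lambda>p. g p (X p) (Y p)))"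

text \<open>Only the values of a connection on pairs of vector fields carry information.\<close>

type_synonym 'm connection = "'m vfield \<Rightarrow> 'm vfield \<Rightarrow> 'm vfield"

definition affine_connection ::
  "('m::topological_space, 'e::euclidean_space) chart set \<Rightarrow> 'm connection \<Rightarrow> bool" where
  "affine_connection A D \<longleftrightarrow>
     (\<forall>X\<in>vector_fields A. \<forall>Y\<in>vector_fields A. D X Y \<in> vector_fields A \<and>
        (\<forall>Z\<in>vector_fields A. D (X + Y) Z = D X Z + D Y Z \<and> D X (Y + Z) = D X Y + D X Z) \<and>
        (\<forall>h. smooth_fun_on A UNIV h \<longrightarrow>
           D (fun_scale h X) Y = fun_scale h (D X Y) \<and>
           D X (fun_scale h Y) = fun_scale (\<lambda>p. X p h) Y + fun_scale h (D X Y)))"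

definition levi_civita ::
  "('m::topological_space, 'e::euclidean_space) chart set \<Rightarrow> 'm metric_tensor \<Rightarrow> 'm connection \<Rightarrow> bool" where
  "levi_civita A g D \<longleftrightarrow> affine_connection A D \<and>
     (\<forall>X\<in>vector_fields A. \<forall>Y\<in>vector_fields A.
        D X Y - D Y X = lie_bracket A X Y \<and>
        (\<forall>Z\<in>vector_fields A. \<forall>p.
           X p (\<lambda>q. g q (Y q) (Z q)) = g p (D X Y p) (Z p) + g p (Y p) (D X Z p)))"

definition curvature ::
  "('m::topological_space, 'e::euclidean_space) chart set \<Rightarrow> 'm connection \<Rightarrow>
   'm vfield \<Rightarrow> 'm vfield \<Rightarrow> 'm vfield \<Rightarrow> 'm vfield" where
  "curvature A D X Y Z = D X (D Y Z) - D Y (D X Z) - D (lie_bracket A X Y) Z"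

text \<open>\<open>(\<nabla>\<^sub>V R)(X, Y) Z\<close>\<close>

definition nabla_curvature ::
  "('m::topological_space, 'e::euclidean_space) chart set \<Rightarrow> 'm connection \<Rightarrow>
   'm vfield \<Rightarrow> 'm vfield \<Rightarrow> 'm vfield \<Rightarrow> 'm vfield \<Rightarrow> 'm vfield" where
  "nabla_curvature A D V X Y Z = D V (curvature A D X Y Z)
     - curvature A D (D V X) Y Z - curvature A D X (D V Y) Z - curvature A D X Y (D V Z)"

type_synonym 'm tensor21 = "'m \<Rightarrow> 'm tangent \<Rightarrow> 'm tangent \<Rightarrow> 'm tangent"

definition tapply :: "'m tensor21 \<Rightarrow> 'm vfield \<Rightarrow> 'm vfield \<Rightarrow> 'm vfield" where
  "tapply T X Y = (\<lambda>p. T p (X p) (Y p))"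

definition tensor_field21 ::
  "('m::topological_space, 'e::euclidean_space) chart set \<Rightarrow> 'm tensor21 \<Rightarrow> bool" where
  "tensor_field21 A T \<longleftrightarrow>
     (\<forall>p. \<forall>u\<in>tangent_space A p. \<forall>v\<in>tangent_space A p. T p u v \<in> tangent_space A p \<and>
        (\<forall>w\<in>tangent_space A p. \<forall>a b.
           T p (\<lambda>f. a * u f + b * v f) w = (\<lambda>f. a * T p u w f + b * T p v w f) \<and>
           T p w (\<lambda>f. a * u f + b * v f) = (\<lambda>f. a * T p w u f + b * T p w v f))) \<and>
     (\<forall>X\<in>vector_fields A. \<forall>Y\<in>vector_fields A. tapply T X Y \<in> vector_fields A)"

text \<open>\<open>(\<nabla>\<^sub>X T)\<^sub>Y Z\<close>\<close>

definition nabla_tensor :: "'m connection \<Rightarrow> 'm tensor21 \<Rightarrow> 'm vfield \<Rightarrow> 'm vfield \<Rightarrow> 'm vfield \<Rightarrow> 'm vfield" where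
  "nabla_tensor D T X Y Z = D X (tapply T Y Z) - tapply T (D X Y) Z - tapply T Y (D X Z)"

text \<open>By uniqueness of the Levi-Civita connection, the existential quantifier just names it.\<close>

definition homogeneous_structure ::
  "('m::topological_space, 'e::euclidean_space) chart set \<Rightarrow> 'm metric_tensor \<Rightarrow> 'm tensor21 \<Rightarrow> bool" where
  "homogeneous_structure A g T \<longleftrightarrow> tensor_field21 A T \<and>
     (\<exists>D. levi_civita A g D \<and>
       (\<forall>V\<in>vector_fields A. \<forall>X\<in>vector_fields A. \<forall>Y\<in>vector_fields A. \<forall>Z\<in>vector_fields A.
          nabla_curvature A D V X Y Z =
            tapply T V (curvature A D X Y Z) - curvature A D (tapply T V X) Y Z
            - curvature A D X (tapply T V Y) Z - curvature A D X Y (tapply T V Z) \<and>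
          nabla_tensor D T X Y Z =
            tapply T X (tapply T Y Z) - tapply T Y (tapply T X Z) - tapply T (tapply T X Y) Z \<and>
          (\<forall>p. g p (tapply T X Y p) (Z p) + g p (Y p) (tapply T X Z p) = 0)))"

definition naturally_reductive ::
  "('m::topological_space, 'e::euclidean_space) chart set \<Rightarrow> 'm metric_tensor \<Rightarrow> bool" where
  "naturally_reductive A g \<longleftrightarrow>
     (\<exists>T. homogeneous_structure A g T \<and> (\<forall>X\<in>vector_fields A. tapply T X X = 0))"


section \<open>The Lie algebra \<open>\<nn>(j)\<close>\<close>

text \<open>The quaternion with components \<open>a, b, c, d\<close> is \<open>a + b \<i> + c \<j> + d \<k>\<close>. Pure quaternions are identified
  with \<^typ>\<open>real^3\<close>, the basis \<open>\<i>, \<j>, \<k>\<close> corresponding to the coordinates 1, 2, 3.\<close>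

datatype quaternion = Quaternion real real real real

fun quat_mult :: "quaternion \<Rightarrow> quaternion \<Rightarrow> quaternion" where
  "quat_mult (Quaternion a b c d) (Quaternion a' b' c' d') = Quaternion
     (a * a' - b * b' - c * c' - d * d')
     (a * b' + b * a' + c * d' - d * c')
     (a * c' - b * d' + c * a' + d * b')
     (a * d' + b * c' - c * b' + d * a')"

definition quat_pure :: "real^3 \<Rightarrow> quaternion" where
  "quat_pure x = Quaternion 0 (x $ 1) (x $ 2) (x $ 3)"

fun quat_Im :: "quaternion \<Rightarrow> real^3" where
  "quat_Im (Quaternion a b c d) = vector [b, c, d]"

text \<open>Elements of \<open>\<nn> = \<vv> \<oplus> \<zz>\<close> have the form \<open>((L, R), C)\<close>. The inner product of the product type makes
  the standard basis orthonormal.\<close>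

type_synonym nil_v = "(real^3) \<times> (real^3)"
type_synonym nil_z = "real^3"
type_synonym nil_n = "nil_v \<times> nil_z"

definition j_map :: "nil_z \<Rightarrow> nil_v \<Rightarrow> nil_v" where
  "j_map C V = (case V of (L, R) \<Rightarrow>
     (quat_Im (quat_mult (quat_pure C) (quat_pure L)), quat_Im (quat_mult (quat_pure C) (quat_pure R))))"

text \<open>The unique bracket with values in \<open>\<zz>\<close>, vanishing on \<open>\<zz>\<close>, such that
  \<open>g([V, W], Z) = g(j\<^sub>Z V, W)\<close>; see \<open>n_bracket_adjoint\<close> below.\<close>

definition n_bracket :: "nil_n \<Rightarrow> nil_n \<Rightarrow> nil_n" where
  "n_bracket x y = (0, \<Sum>b\<in>Basis. (j_map b (fst x) \<bullet> fst y) *\<^sub>R b)"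

lemma j_map_cross: "j_map C (L, R) = (cross3 C L, cross3 C R)"
  by (simp add: j_map_def quat_pure_def cross3_def vec_eq_iff forall_3)

lemma j_map_skew: "j_map C V \<bullet> W = - (V \<bullet> j_map C W)"
proof -
  have *: "cross3 C x \<bullet> y = - (x \<bullet> cross3 C y)" for x y :: "real^3"
    by (simp add: cross3_def inner_vec_def sum_3 algebra_simps)
  show ?thesis
    by (cases V; cases W) (simp add: j_map_cross * del: inner_minus_right inner_minus_left)
qed

lemma linear_j_map_left: "linear (\<lambda>C. j_map C V)"
  by (cases V) (auto intro!: linearI simp: j_map_cross cross_add_left cross_mult_left)

lemma n_bracket_adjoint: "n_bracket (V, A) (W, B) \<bullet> (0, Z) = j_map Z V \<bullet> W"
proof -
  have "j_map Z V = j_map (\<Sum>b\<in>Basis. (Z \<bullet> b) *\<^sub>R b) V"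
    by (simp add: euclidean_representation)
  also have "\<dots> = (\<Sum>b\<in>Basis. (Z \<bullet> b) *\<^sub>R j_map b V)"
    by (simp add: linear_sum[OF linear_j_map_left] linear_cmul[OF linear_j_map_left])
  finally have "j_map Z V \<bullet> W = (\<Sum>b\<in>Basis. (Z \<bullet> b) * (j_map b V \<bullet> W))"
    by (simp add: inner_sum_left)
  then show ?thesis
    by (simp add: n_bracket_def inner_sum_left inner_commute[of Z] mult.commute)
qed

lemma n_bracket_cross: "n_bracket ((L, R), C) ((L', R'), C') = (0, cross3 L L' + cross3 R R')"
proof -
  have "snd (n_bracket ((L, R), C) ((L', R'), C')) \<bullet> Z = (cross3 L L' + cross3 R R') \<bullet> Z" for Z
    using n_bracket_adjoint[of "(L, R)" C "(L', R')" C' Z]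
    by (simp add: j_map_cross n_bracket_def cross3_def inner_vec_def sum_3 algebra_simps)
  then have "snd (n_bracket ((L, R), C) ((L', R'), C')) = cross3 L L' + cross3 R R'"
    by (meson vector_eq_rdot)
  then show ?thesis
    by (simp add: n_bracket_def)
qed


section \<open>The nilpotent Lie group \<open>N(j)\<close>\<close>

text \<open>By the Baker-Campbell-Hausdorff formula, the simply connected Lie group of the 2-step nilpotent
  Lie algebra \<open>\<nn>(j)\<close> is the vector space \<open>\<nn>\<close> with the product below.\<close>

definition nil_group :: "nil_n monoid" where
  "nil_group = \<lparr>carrier = UNIV, mult = (\<lambda>x y. x + y + (1/2) *\<^sub>R n_bracket x y), one = 0\<rparr>"

text \<open>The exponential of \<open>v\<close> is the time 1 value of the one-parameter subgroup with velocity \<open>v\<close>.\<close>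

definition nil_exp :: "nil_n \<Rightarrow> nil_n" where
  "nil_exp v = (THE \<gamma>. (\<forall>s t. \<gamma> (s + t) = \<gamma> s \<otimes>\<^bsub>nil_group\<^esub> \<gamma> t) \<and>
      (\<gamma> has_vector_derivative v) (at 0)) 1"

lemma carrier_nil_group [simp]: "carrier nil_group = UNIV"
  and one_nil_group [simp]: "\<one>\<^bsub>nil_group\<^esub> = 0"
  by (simp_all add: nil_group_def)

lemma mult_nil_group: "x \<otimes>\<^bsub>nil_group\<^esub> y = x + y + (1/2) *\<^sub>R n_bracket x y"
  by (simp add: nil_group_def)

lemma mult_nil_group_cross:
  "((L, R), C) \<otimes>\<^bsub>nil_group\<^esub> ((L', R'), C') =
     ((L + L', R + R'), C + C' + (1/2) *\<^sub>R (cross3 L L' + cross3 R R'))"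
  by (simp add: mult_nil_group n_bracket_cross)

lemma group_nil_group: "group nil_group"
proof (rule groupI)
  fix x y z :: nil_n
  show "x \<otimes>\<^bsub>nil_group\<^esub> y \<otimes>\<^bsub>nil_group\<^esub> z = x \<otimes>\<^bsub>nil_group\<^esub> (y \<otimes>\<^bsub>nil_group\<^esub> z)"
    by (cases x; cases y; cases z)
       (auto simp: mult_nil_group_cross cross_add_left cross_add_right algebra_simps)
next
  fix x :: nil_n
  show "\<one>\<^bsub>nil_group\<^esub> \<otimes>\<^bsub>nil_group\<^esub> x = x"
    by (cases x) (auto simp: mult_nil_group_cross zero_prod_def)
  show "\<exists>y\<in>carrier nil_group. y \<otimes>\<^bsub>nil_group\<^esub> x = \<one>\<^bsub>nil_group\<^esub>"
    by (rule bexI[of _ "- x"])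
       (cases x; auto simp: mult_nil_group_cross zero_prod_def cross_minus_left cross_refl)+
qed auto

lemma inv_nil_group: "inv\<^bsub>nil_group\<^esub> x = - x"
proof -
  have "- x \<otimes>\<^bsub>nil_group\<^esub> x = \<one>\<^bsub>nil_group\<^esub>"
    by (cases x) (auto simp: mult_nil_group_cross zero_prod_def cross_minus_left cross_refl)
  then show ?thesis
    by (simp add: group.inv_equality[OF group_nil_group])
qed

lemma additive_derivative_at_0:
  fixes f :: "real \<Rightarrow> 'a::real_normed_vector"
  assumes add: "\<And>s t. f (s + t) = f s + f t" and der: "(f has_vector_derivative v) (at 0)"
  shows "f t = t *\<^sub>R v"
proof -
  have "((\<lambda>t. f t - t *\<^sub>R v) has_vector_derivative 0) (at s)" for s
  proof -
    have "((\<lambda>t. f s + f (t - s)) has_vector_derivative v) (at s)"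
    proof -
      have "((f \<circ> (\<lambda>t. t - s)) has_vector_derivative 1 *\<^sub>R v) (at s)"
        by (rule vector_diff_chain_at) (auto intro!: derivative_eq_intros simp: der)
      then show ?thesis
        by (auto simp: o_def intro!: derivative_eq_intros)
    qed
    then have "(f has_vector_derivative v) (at s)"
      by (simp flip: add)
    then show ?thesis
      by (auto intro!: derivative_eq_intros)
  qed
  then obtain c where c: "\<And>t. f t - t *\<^sub>R v = c"
    using has_vector_derivative_zero_constant[of UNIV "\<lambda>t. f t - t *\<^sub>R v"] by auto
  moreover have "f 0 = 0"
    using add[of 0 0] by simp
  ultimately show ?thesis
    by (metis diff_zero eq_iff_diff_eq_0 scale_zero_left)
qed

lemma nil_exp_eq [simp]: "nil_exp v = v"
proof -
  have br: "n_bracket (s *\<^sub>R v) (t *\<^sub>R v) = 0" for s t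
    by (cases v) (auto simp: n_bracket_cross zero_prod_def cross_mult_left cross_mult_right cross_refl)
  have "(THE \<gamma>. (\<forall>s t. \<gamma> (s + t) = \<gamma> s \<otimes>\<^bsub>nil_group\<^esub> \<gamma> t) \<and>
      (\<gamma> has_vector_derivative v) (at 0)) = (\<lambda>t. t *\<^sub>R v)"
  proof (rule the_equality)
    show "(\<forall>s t. (s + t) *\<^sub>R v = (s *\<^sub>R v) \<otimes>\<^bsub>nil_group\<^esub> (t *\<^sub>R v)) \<and>
      ((\<lambda>t. t *\<^sub>R v) has_vector_derivative v) (at 0)"
      by (auto simp: mult_nil_group br scaleR_add_left intro!: derivative_eq_intros)
  next
    fix \<gamma> assume asm: "(\<forall>s t. \<gamma> (s + t) = \<gamma> s \<otimes>\<^bsub>nil_group\<^esub> \<gamma> t) \<and> (\<gamma> has_vector_derivative v) (at 0)"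
    then have der: "(\<gamma> has_vector_derivative v) (at 0)"
      and hom: "\<And>s t. \<gamma> (s + t) = \<gamma> s + \<gamma> t + (1/2) *\<^sub>R n_bracket (\<gamma> s) (\<gamma> t)"
      by (auto simp: mult_nil_group)
    have "((\<lambda>t. fst (\<gamma> t)) has_vector_derivative fst v) (at 0)"
      using der unfolding has_vector_derivative_def
      by (auto dest: has_derivative_fst)
    moreover have "fst (\<gamma> (s + t)) = fst (\<gamma> s) + fst (\<gamma> t)" for s t
      by (simp add: hom n_bracket_def)
    ultimately have 1: "fst (\<gamma> t) = t *\<^sub>R fst v" for t
      by (rule additive_derivative_at_0[rotated])
    have "n_bracket (\<gamma> s) (\<gamma> t) = n_bracket (s *\<^sub>R v) (t *\<^sub>R v)" for s t
      by (simp add: n_bracket_def 1)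
    then have "\<gamma> (s + t) = \<gamma> s + \<gamma> t" for s t
      by (simp add: hom br)
    then show "\<gamma> = (\<lambda>t. t *\<^sub>R v)"
      using additive_derivative_at_0[OF _ der] by blast
  qed
  then show ?thesis
    by (simp add: nil_exp_def)
qed

text \<open>The left-invariant vector field with value \<open>v\<close> at the identity is \<open>x \<mapsto> v + 1/2 [x, v]\<close>, and the
  Lie bracket of two such fields (as vector fields on the vector space \<open>\<nn>\<close>) is given by the bracket
  of \<open>\<nn>(j)\<close>: the Lie algebra of the group is indeed \<open>\<nn>(j)\<close>.\<close>

lemma left_invariant_field:
  "((\<lambda>t. x \<otimes>\<^bsub>nil_group\<^esub> (t *\<^sub>R v)) has_vector_derivative v + (1/2) *\<^sub>R n_bracket x v) (at 0)"
proof -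
  have "x \<otimes>\<^bsub>nil_group\<^esub> (t *\<^sub>R v) = x + t *\<^sub>R (v + (1/2) *\<^sub>R n_bracket x v)" for t
    by (cases x; cases v) (auto simp: mult_nil_group_cross n_bracket_cross cross_mult_right algebra_simps)
  then show ?thesis
    by (auto intro!: derivative_eq_intros)
qed

lemma left_invariant_bracket:
  fixes v w :: nil_n
  defines "F \<equiv> \<lambda>v x. v + (1/2) *\<^sub>R n_bracket x v"
  shows "frechet_derivative (F w) (at x) (F v x) - frechet_derivative (F v) (at x) (F w x)
           = F (n_bracket v w) x"
proof -
  have lin: "bounded_linear (\<lambda>x. n_bracket x u)" for u
    by (subst linear_conv_bounded_linear[symmetric], rule linearI; cases u)
       (auto simp: n_bracket_cross cross_add_left cross_mult_left algebra_simps)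
  have der: "frechet_derivative (F u) (at x) = (\<lambda>\<xi>. (1/2) *\<^sub>R n_bracket \<xi> u)" for u
    unfolding F_def
    by (rule frechet_derivative_at[symmetric])
       (auto intro!: derivative_eq_intros bounded_linear.has_derivative[OF lin])
  show ?thesis
    unfolding der
  proof -
    obtain a b c a' b' c' p q r where "v = ((a, b), c)" "w = ((a', b'), c')" "x = ((p, q), r)"
      by (metis surj_pair)
    then show "(1/2) *\<^sub>R n_bracket (F v x) w - (1/2) *\<^sub>R n_bracket (F w x) v = F (n_bracket v w) x"
      by (simp add: F_def n_bracket_cross cross3_def vec_eq_iff forall_3 zero_prod_def field_simps)
  qed
qed

text \<open>\<open>N(j)\<close> as a smooth manifold. \<open>nil_vec x \<xi>\<close> is the tangent vector at \<open>x\<close> with coordinates \<open>\<xi>\<close>;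
  \<open>nil_vec 0\<close> identifies \<open>\<nn>\<close> with the tangent space at the identity.\<close>

definition nil_atlas :: "(nil_n, nil_n) chart set" where
  "nil_atlas = {(UNIV, \<lambda>x. x)}"

definition nil_vec :: "nil_n \<Rightarrow> nil_n \<Rightarrow> nil_n tangent" where
  "nil_vec x \<xi> = coord_vector nil_atlas (UNIV, \<lambda>x. x) x \<xi>"

definition left_invariant_metric :: "nil_n metric_tensor" where
  "left_invariant_metric x u v =
     (let to_n = (\<lambda>w. the_inv (nil_vec 0)
            (differential nil_atlas (\<lambda>y. inv\<^bsub>nil_group\<^esub> x \<otimes>\<^bsub>nil_group\<^esub> y) x w))
      in to_n u \<bullet> to_n v)"


section \<open>The compact nilmanifold \<open>N\<^sup>j = \<Gamma>(j) \ N(j)\<close>\<close>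

definition lattice_basis :: "nil_n set" where
  "lattice_basis = range (\<lambda>i. ((axis i 1, 0), 0)) \<union> range (\<lambda>i. ((0, axis i 1), 0))
     \<union> range (\<lambda>i. ((0, 0), (1/2) *\<^sub>R axis i 1))"

definition lattice :: "nil_n set" where
  "lattice = {\<Sum>b\<in>lattice_basis. of_int (c b) *\<^sub>R b | c :: nil_n \<Rightarrow> int. True}"

definition Gamma_j :: "nil_n set" where
  "Gamma_j = nil_exp ` lattice"

lemma lattice_iff:
  "((L, R), C) \<in> lattice \<longleftrightarrow> (\<forall>i. L $ i \<in> \<int> \<and> R $ i \<in> \<int> \<and> 2 * C $ i \<in> \<int>)"
proof
  assume "((L, R), C) \<in> lattice"
  then obtain c :: "nil_n \<Rightarrow> int" where c: "((L, R), C) = (\<Sum>b\<in>lattice_basis. of_int (c b) *\<^sub>R b)"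
    by (auto simp: lattice_def)
  have eqs: "L $ i = (\<Sum>b\<in>lattice_basis. of_int (c b) * (fst (fst b) $ i))"
    "R $ i = (\<Sum>b\<in>lattice_basis. of_int (c b) * (snd (fst b) $ i))"
    "2 * C $ i = (\<Sum>b\<in>lattice_basis. of_int (c b) * (2 * (snd b $ i)))" for i
    using arg_cong[OF c, of "\<lambda>b. fst (fst b) $ i"] arg_cong[OF c, of "\<lambda>b. snd (fst b) $ i"]
      arg_cong[OF c, of "\<lambda>b. snd b $ i"]
    by (simp_all add: fst_sum snd_sum sum_distrib_left mult.left_commute[of 2])
  have coord: "fst (fst b) $ i \<in> \<int> \<and> snd (fst b) $ i \<in> \<int> \<and> 2 * (snd b $ i) \<in> \<int>"
    if "b \<in> lattice_basis" for b i
    using that by (auto simp: lattice_basis_def axis_def)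
  have int_sum: "(\<Sum>b\<in>lattice_basis. of_int (c b) * h b) \<in> \<int>"
    if "\<And>b. b \<in> lattice_basis \<Longrightarrow> h b \<in> \<int>" for h :: "nil_n \<Rightarrow> real"
    by (intro Ints_sum Ints_mult Ints_of_int that)
  show "\<forall>i. L $ i \<in> \<int> \<and> R $ i \<in> \<int> \<and> 2 * C $ i \<in> \<int>"
    unfolding eqs by (intro allI conjI int_sum) (simp_all add: coord)
next
  assume int: "\<forall>i. L $ i \<in> \<int> \<and> R $ i \<in> \<int> \<and> 2 * C $ i \<in> \<int>"
  define c where "c b = \<lfloor>L \<bullet> fst (fst b) + R \<bullet> snd (fst b) + 4 * (C \<bullet> snd b)\<rfloor>" for b :: nil_n
  let ?X = "\<lambda>i::3. (((axis i 1, 0), 0) :: nil_n)" and ?Y = "\<lambda>i::3. (((0, axis i 1), 0) :: nil_n)"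
    and ?Z = "\<lambda>i::3. (((0, 0), (1/2) *\<^sub>R axis i 1) :: nil_n)"
  have cX: "of_int (c (?X i)) = L $ i" "of_int (c (?Y i)) = R $ i" "of_int (c (?Z i)) = 2 * C $ i" for i
    using int by (simp_all add: c_def inner_axis)
  have inj: "inj ?X" "inj ?Y" "inj ?Z"
    by (auto intro!: injI simp: axis_eq_axis)
  have disj: "range ?X \<inter> range ?Y = {}" "(range ?X \<union> range ?Y) \<inter> range ?Z = {}"
    by (auto simp: axis_eq_0_iff)
  have "(\<Sum>b\<in>lattice_basis. of_int (c b) *\<^sub>R b) =
     (\<Sum>i\<in>UNIV. of_int (c (?X i)) *\<^sub>R ?X i) + (\<Sum>i\<in>UNIV. of_int (c (?Y i)) *\<^sub>R ?Y i)
     + (\<Sum>i\<in>UNIV. of_int (c (?Z i)) *\<^sub>R ?Z i)"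
    unfolding lattice_basis_def
    by (subst sum.union_disjoint; (simp add: disj sum.reindex[OF inj(1)] sum.reindex[OF inj(2)] sum.reindex[OF inj(3)])?)
       (subst sum.union_disjoint; simp add: disj sum.reindex[OF inj(1)] sum.reindex[OF inj(2)] sum.reindex[OF inj(3)])
  also have "\<dots> = ((L, R), C)"
    unfolding cX
    by (auto simp: prod_eq_iff fst_sum snd_sum vec_eq_iff sum_3 forall_3 axis_def)
  finally show "((L, R), C) \<in> lattice"
    unfolding lattice_def mem_Collect_eq by (intro exI[of _ c] conjI TrueI) (rule sym)
qed

lemma subgroup_Gamma_j: "subgroup Gamma_j nil_group"
proof -
  have half: "(2 * a - 2 * b + (2 * c - 2 * d)) / 2 \<in> \<int>"
    if "a \<in> \<int>" "b \<in> \<int>" "c \<in> \<int>" "d \<in> \<int>" for a b c d :: real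
  proof -
    have "(2 * a - 2 * b + (2 * c - 2 * d)) / 2 = a - b + (c - d)"
      by simp
    then show ?thesis
      using that by (simp only:) (intro Ints_add Ints_diff)
  qed
  have "Gamma_j = lattice"
    by (simp add: Gamma_j_def)
  moreover have "x \<otimes>\<^bsub>nil_group\<^esub> y \<in> lattice" if "x \<in> lattice" "y \<in> lattice" for x y
    using that
    by (cases x; cases y)
       (auto simp: mult_nil_group_cross lattice_iff cross3_def forall_3 intro!: half)
  moreover have "- x \<in> lattice" if "x \<in> lattice" for x
    using that by (cases x) (auto simp: lattice_iff)
  moreover have "0 \<in> lattice"
    by (simp add: zero_prod_def lattice_iff)
  ultimately show ?thesis
    by (intro group.subgroupI[OF group_nil_group]) (auto simp: inv_nil_group)
qed

typedef nilmanifold = "rcosets\<^bsub>nil_group\<^esub> Gamma_j"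
  by (auto simp: RCOSETS_def)

definition nil_proj :: "nil_n \<Rightarrow> nilmanifold" where
  "nil_proj x = Abs_nilmanifold (Gamma_j #>\<^bsub>nil_group\<^esub> x)"

instantiation nilmanifold :: topological_space
begin

definition open_nilmanifold :: "nilmanifold set \<Rightarrow> bool" where
  "open_nilmanifold U \<longleftrightarrow> open (nil_proj -` U)"

instance
  by standard (auto simp: open_nilmanifold_def vimage_Union)

end

text \<open>The charts are the local inverses of the projection.\<close>

definition nilmanifold_atlas :: "(nilmanifold, nil_n) chart set" where
  "nilmanifold_atlas = {(nil_proj ` W, inv_into W nil_proj) | W. open W \<and> inj_on nil_proj W}"

text \<open>The induced metric, for which the projection is a local isometry: tangent vectors are lifted to
  some point of the fibre. The choice is irrelevant because the metric upstairs is left-invariant.\<close>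

definition nilmanifold_metric :: "nilmanifold metric_tensor" where
  "nilmanifold_metric p u v =
     (let x = (SOME x. nil_proj x = p);
          lift = the_inv_into (tangent_space nil_atlas x) (differential nilmanifold_atlas nil_proj x)
      in left_invariant_metric x (lift u) (lift v))"

end

theory Submission
  imports Defs
begin

text \<open>\<open>N\<^sup>j\<close> is parallelised by the left-invariant vector fields, which are invariant under left translation by
  \<open>\<Gamma>(j)\<close> and hence descend. In this frame a vector field is a smooth \<open>\<nn>\<close>-valued function, the metric is the
  constant inner product, and \<open>\<nabla>\<^sub>\<xi>\<eta> = \<xi>(\<eta>) + lc \<xi> \<eta>\<close> for a bilinear map \<open>lc\<close> on \<open>\<nn>\<close>. Since
  \<open>j\<^sub>C\<close> acts by \<open>L \<mapsto> C \<times> L\<close> on both summands, \<open>j\<close> is a representation of \<open>\<zz> \<cong> so(3)\<close>, and the diagonal action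
  of \<open>so(3)\<close> on \<open>\<nn>\<close> preserves the bracket and the inner product. The totally skew tensor \<open>T = nr\<close> is such that
  \<open>\<nabla> - T\<close> differentiates constant-coefficient fields by this action, so it annihilates every
  tensor built from bracket and metric, in particular \<open>R\<close> and \<open>T\<close>. These are the
  conditions (1) and (2).\<close>

section \<open>Calculus of smooth maps\<close>

text \<open>Left translations of \<open>N(j)\<close> need not descend to the quotient, but
  left-invariant tensors do; natural reductivity phrased through T is therefore checked in the
  invariant frame, without a transitive group on the quotient. Arbitrary vector fields have
  nonconstant coefficients. Since metric, curvature and T have constant coefficients in the frame,
  the Leibniz rule removes all derivatives of coefficients from (1) and (2), leaving identities
  between bilinear maps on the Lie algebra. The only input there is the Jacobi identity of the cross
  product. On the centre \<open>lc\<close> vanishes while the so(3) action is the cross product, so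
  T itself must supply that term. Two obstacles shape the rest. Tangent vectors are functionals on
  locally smooth functions, and metric and derivatives are defined through an arbitrary point of a
  fibre; invariance under the lattice makes each choice harmless. Torsion and curvature need
  commutators of frame fields acting on functions smooth only near a point, hence a local form of
  the symmetry of second derivatives.\<close>

lemma has_derivative_frechet:
  "f differentiable (at x) \<Longrightarrow> (f has_derivative frechet_derivative f (at x)) (at x)"
  by (simp add: frechet_derivative_works)

lemma frechet_derivative_eqI:
  "(f has_derivative f') (at x) \<Longrightarrow> frechet_derivative f (at x) = f'"
  by (rule frechet_derivative_at[symmetric])

lemma differentiable_transform_open:
  assumes "f differentiable (at x)" "open S" "x \<in> S" "\<And>y. y \<in> S \<Longrightarrow> f y = g y"
  shows "g differentiable (at x)"
  using assms has_derivative_transform_within_open unfolding differentiable_def by blast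

section \<open>Closure properties of maps of class C^k\<close>

lemma C_k_on_cong:
  assumes "open S" "\<And>x. x \<in> S \<Longrightarrow> f x = g x" "C_k_on k S f"
  shows "C_k_on k S g"
  using assms(2,3)
proof (induction k arbitrary: f g)
  case 0
  then show ?case by (auto cong: continuous_on_cong)
next
  case (Suc k)
  have "frechet_derivative g (at x) = frechet_derivative f (at x)" if "x \<in> S" for x
    using Suc.prems that frechet_derivative_transform_within_open[of f x S g] assms(1) by auto
  moreover have "g differentiable (at x)" if "x \<in> S" for x
    using Suc.prems that differentiable_transform_open[OF _ assms(1), of f x g] by auto
  moreover have "C_k_on k S (\<lambda>x. frechet_derivative f (at x) \<xi>)" for \<xi>
    using Suc.prems by simp
  ultimately show ?case
    using Suc.IH[of "\<lambda>x. frechet_derivative f (at x) \<xi>" "\<lambda>x. frechet_derivative g (at x) \<xi>" for \<xi>]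
    by simp
qed

lemma C_k_on_subset: "C_k_on k S f \<Longrightarrow> T \<subseteq> S \<Longrightarrow> C_k_on k T f"
  by (induction k arbitrary: f) (auto intro: continuous_on_subset)

lemma C_k_on_local:
  assumes "\<And>x. x \<in> S \<Longrightarrow> \<exists>T. open T \<and> x \<in> T \<and> C_k_on k T f"
  shows "C_k_on k S f"
  using assms
proof (induction k arbitrary: f)
  case 0
  have "isCont f x" if "x \<in> S" for x
    using 0[OF that] by (auto simp: continuous_on_eq_continuous_at)
  then show ?case by (simp add: continuous_at_imp_continuous_on)
next
  case (Suc k)
  have "C_k_on k S (\<lambda>x. frechet_derivative f (at x) \<xi>)" for \<xi>
    by (rule Suc.IH) (use Suc.prems in force)
  then show ?case using Suc.prems by force
qed

lemma C_k_on_SucD: "C_k_on (Suc k) S f \<Longrightarrow> C_k_on k S f"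
proof (induction k arbitrary: f)
  case 0
  then show ?case
    by (auto intro: differentiable_at_imp_differentiable_on differentiable_imp_continuous_on)
qed auto

text \<open>On an open set the derivative may be replaced by any closed form for it, so inductions
  on \<open>k\<close> never have to unfold \<open>frechet_derivative\<close>.\<close>

lemma C_k_on_SucI:
  assumes "open S" "\<And>x. x \<in> S \<Longrightarrow> (f has_derivative f' x) (at x)" "\<And>\<xi>. C_k_on k S (\<lambda>x. f' x \<xi>)"
  shows "C_k_on (Suc k) S f"
proof -
  have "C_k_on k S (\<lambda>x. frechet_derivative f (at x) \<xi>)" for \<xi>
    using C_k_on_cong[OF assms(1) _ assms(3)] frechet_derivative_eqI[OF assms(2)] by simp
  then show ?thesis
    using assms(2) by (auto simp: differentiable_def)
qed

lemma C_k_on_SucE: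
  assumes "C_k_on (Suc k) S f"
  shows "x \<in> S \<Longrightarrow> (f has_derivative frechet_derivative f (at x)) (at x)"
    and "C_k_on k S (\<lambda>x. frechet_derivative f (at x) \<xi>)"
  using assms by (auto intro: has_derivative_frechet)

lemma C_k_on_const: "C_k_on k S (\<lambda>x. c)"
  by (induction k arbitrary: c) auto

lemma C_k_on_add:
  assumes "open S" "C_k_on k S f" "C_k_on k S g"
  shows "C_k_on k S (\<lambda>x. f x + g x)"
  using assms(2,3)
proof (induction k arbitrary: f g)
  case (Suc k)
  show ?case
    by (rule C_k_on_SucI[OF assms(1) has_derivative_add[OF C_k_on_SucE(1)[OF Suc.prems(1)] C_k_on_SucE(1)[OF Suc.prems(2)]]])
       (use Suc.IH C_k_on_SucE(2) Suc.prems in blast)+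
qed (auto intro: continuous_on_add)

lemma C_k_on_linear_compose:
  assumes "open S" "bounded_linear L" "C_k_on k S f"
  shows "C_k_on k S (\<lambda>x. L (f x))"
  using assms(3)
proof (induction k arbitrary: f)
  case 0
  then show ?case using bounded_linear.continuous_on[OF assms(2)] by auto
next
  case (Suc k)
  show ?case
    by (rule C_k_on_SucI[OF assms(1) bounded_linear.has_derivative[OF assms(2) C_k_on_SucE(1)[OF Suc.prems]]])
       (use Suc.IH[OF C_k_on_SucE(2)[OF Suc.prems]] in auto)
qed

lemma C_k_on_bounded_linear:
  assumes "bounded_linear L" shows "C_k_on k S L"
proof (cases k)
  case (Suc k')
  have "frechet_derivative L (at x) = L" for x
    by (rule frechet_derivative_eqI) (rule bounded_linear_imp_has_derivative[OF assms])
  then show ?thesis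
    using assms by (auto simp: Suc C_k_on_const bounded_linear_imp_differentiable)
qed (use assms linear_continuous_on in auto)

lemma C_k_on_bilinear:
  assumes "open S" "bounded_bilinear B" "C_k_on k S f" "C_k_on k S g"
  shows "C_k_on k S (\<lambda>x. B (f x) (g x))"
  using assms(3,4)
proof (induction k arbitrary: f g)
  case 0
  then show ?case using bounded_bilinear.continuous_on[OF assms(2)] by auto
next
  case (Suc k)
  show ?case
  proof (rule C_k_on_SucI[OF assms(1)])
    show "((\<lambda>x. B (f x) (g x)) has_derivative
        (\<lambda>\<xi>. B (f x) (frechet_derivative g (at x) \<xi>) + B (frechet_derivative f (at x) \<xi>) (g x))) (at x)"
      if "x \<in> S" for x
      by (rule bounded_bilinear.FDERIV[OF assms(2)]) (rule C_k_on_SucE(1)[OF _ that], rule Suc.prems)+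
    show "C_k_on k S (\<lambda>x. B (f x) (frechet_derivative g (at x) \<xi>) + B (frechet_derivative f (at x) \<xi>) (g x))" for \<xi>
      by (rule C_k_on_add[OF assms(1)]; rule Suc.IH)
         (rule C_k_on_SucD[OF Suc.prems(1)] C_k_on_SucD[OF Suc.prems(2)]
            C_k_on_SucE(2)[OF Suc.prems(1)] C_k_on_SucE(2)[OF Suc.prems(2)])+
  qed
qed

text \<open>The derivative of an affine map is the constant \<open>L\<close>, so a directional
  derivative of the composite is again a function composed with \<open>g\<close> and the induction
  closes. Left translations are affine, which makes this special chain rule sufficient.\<close>

lemma C_k_on_affine_compose:
  assumes L: "bounded_linear L" and g: "\<And>x. g x = a + L x" and S: "open S" and "C_k_on k S f"
  shows "C_k_on k (g -` S) (\<lambda>x. f (g x))"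
  using assms(4)
proof (induction k arbitrary: f)
  case 0
  have "continuous_on (g -` S) g"
    unfolding g by (intro continuous_intros linear_continuous_on L)
  then show ?case
    using 0 by (auto intro: continuous_on_compose2)
next
  case (Suc k)
  have gd: "(g has_derivative L) (at x)" for x
    unfolding g using has_derivative_add[OF has_derivative_const bounded_linear_imp_has_derivative[OF L]]
    by simp
  show ?case
  proof (rule C_k_on_SucI)
    show "open (g -` S)"
      using gd S by (intro continuous_open_vimage) (auto intro: has_derivative_continuous)
    show "((\<lambda>x. f (g x)) has_derivative (\<lambda>\<xi>. frechet_derivative f (at (g x)) (L \<xi>))) (at x)"
      if "x \<in> g -` S" for x
      by (rule has_derivative_compose[OF gd C_k_on_SucE(1)[OF Suc.prems]]) (use that in auto)
    show "C_k_on k (g -` S) (\<lambda>x. frechet_derivative f (at (g x)) (L \<xi>))" for \<xi>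
      by (rule Suc.IH[OF C_k_on_SucE(2)[OF Suc.prems]])
  qed
qed

text \<open>Two applications of the mean value theorem, in either order, express the same second
  difference through either mixed derivative at some nearby point. If the mixed derivatives differed
  at \<open>x\<close>, continuity would keep them apart nearby, contradicting the equality of these
  two values.\<close>

lemma symmetric_second_derivative_real:
  fixes f :: "'a::euclidean_space \<Rightarrow> real"
  assumes S: "open S" "x \<in> S" and f: "C_k_on 2 S f"
  shows "frechet_derivative (\<lambda>y. frechet_derivative f (at y) u) (at x) v =
         frechet_derivative (\<lambda>y. frechet_derivative f (at y) v) (at x) u"
proof (rule ccontr)
  define D where "D u v y = frechet_derivative (\<lambda>y. frechet_derivative f (at y) u) (at y) v" for u v y
  assume "\<not> ?thesis"
  then have "dist (D u v x) (D v u x) > 0"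
    by (simp add: D_def)
  then obtain e where e: "e > 0" "2 * e = dist (D u v x) (D v u x)"
    by (metis field_sum_of_halves half_gt_zero mult_2)
  have fd: "f differentiable (at y)" and fdd: "(\<lambda>y. frechet_derivative f (at y) w) differentiable (at y)"
    if "y \<in> S" for y w
    using f that by (auto simp: numeral_2_eq_2)
  have "continuous_on S (D a b)" for a b
    using f by (auto simp: D_def numeral_2_eq_2)
  then have "isCont (D a b) x" for a b
    using S by (simp add: continuous_on_eq_continuous_at)
  then have "\<exists>r>0. \<forall>y. dist y x < r \<longrightarrow> dist (D a b y) (D a b x) < e" for a b
    using e(1) by (simp add: continuous_at_eps_delta)
  then obtain r1 r2 where r: "r1 > 0" "\<And>y. dist y x < r1 \<Longrightarrow> dist (D u v y) (D u v x) < e"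
    "r2 > 0" "\<And>y. dist y x < r2 \<Longrightarrow> dist (D v u y) (D v u x) < e"
    by metis
  obtain r3 where r3: "r3 > 0" "ball x r3 \<subseteq> S"
    using S open_contains_ball by blast
  define \<rho> where "\<rho> = min r1 (min r2 r3)"
  define h where "h = \<rho> / (norm u + norm v + 1)"
  have pos: "norm u + norm v + 1 > 0" by (intro add_nonneg_pos) auto
  have \<rho>: "\<rho> > 0" using r r3 by (auto simp: \<rho>_def)
  have h: "h > 0" using \<rho> pos by (simp add: h_def)
  have near: "dist (x + s *\<^sub>R a + t *\<^sub>R b) x < \<rho>"
    if "0 \<le> s" "s \<le> h" "0 \<le> t" "t \<le> h" "{a, b} = {u, v}" for s t a b
  proof -
    have "dist (x + s *\<^sub>R a + t *\<^sub>R b) x = norm (s *\<^sub>R a + t *\<^sub>R b)"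
      by (simp add: dist_norm add.assoc)
    also have "\<dots> \<le> s * norm a + t * norm b"
      using that by (intro norm_triangle_le) auto
    also have "\<dots> \<le> h * norm a + h * norm b"
      using that by (intro add_mono mult_right_mono) auto
    also have "\<dots> \<le> h * (norm u + norm v)"
      using that h by (auto simp: doubleton_eq_iff algebra_simps)
    also have "\<dots> < h * (norm u + norm v + 1)"
      using h by (simp add: algebra_simps)
    also have "\<dots> = \<rho>"
      using pos by (simp add: h_def)
    finally show ?thesis .
  qed
  have along: "((\<lambda>s. F (p + s *\<^sub>R a)) has_real_derivative frechet_derivative F (at (p + s *\<^sub>R a)) a) (at s)"
    if "F differentiable (at (p + s *\<^sub>R a))" for F :: "'a \<Rightarrow> real" and p a s
  proof -
    have "((\<lambda>s. p + s *\<^sub>R a) has_derivative (\<lambda>t. t *\<^sub>R a)) (at s)"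
      by (auto intro!: derivative_eq_intros)
    then have "((\<lambda>s. F (p + s *\<^sub>R a)) has_derivative
        (\<lambda>t. frechet_derivative F (at (p + s *\<^sub>R a)) (t *\<^sub>R a))) (at s)"
      by (rule has_derivative_compose) (rule has_derivative_frechet[OF that])
    then show ?thesis
      by (simp add: has_field_derivative_def linear_cmul[OF linear_frechet_derivative[OF that]]
          mult_commute_abs)
  qed
  text \<open>The second difference of \<open>f\<close> is \<open>h\<^sup>2\<close> times a mixed derivative at an intermediate point,
    whichever of the two directions is treated first.\<close>
  have mvt: "\<exists>y. dist y x < \<rho> \<and>
      f (x + h *\<^sub>R a + h *\<^sub>R b) - f (x + h *\<^sub>R a) - (f (x + h *\<^sub>R b) - f x) = h * (h * D a b y)"
    if ab: "{a, b} = {u, v}" for a b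
  proof -
    have inS: "x + s *\<^sub>R a + t *\<^sub>R b \<in> S" if "0 \<le> s" "s \<le> h" "0 \<le> t" "t \<le> h" for s t
      using near[OF that ab] r3 by (auto simp: \<rho>_def dist_commute subset_iff)
    let ?d = "\<lambda>y. frechet_derivative f (at y) a"
    have "\<exists>s. 0 < s \<and> s < h \<and>
       (f (x + h *\<^sub>R b + h *\<^sub>R a) - f (x + h *\<^sub>R a)) - (f (x + h *\<^sub>R b + 0 *\<^sub>R a) - f (x + 0 *\<^sub>R a))
        = (h - 0) * (?d (x + h *\<^sub>R b + s *\<^sub>R a) - ?d (x + s *\<^sub>R a))"
    proof (rule MVT2[OF h, of "\<lambda>s. f (x + h *\<^sub>R b + s *\<^sub>R a) - f (x + s *\<^sub>R a)"])
      fix s assume s: "0 \<le> s" "s \<le> h"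
      have "x + h *\<^sub>R b + s *\<^sub>R a \<in> S" "x + s *\<^sub>R a \<in> S"
        using inS[OF s, of h] inS[OF s, of 0] h by (auto simp: add_ac)
      then show "((\<lambda>s. f (x + h *\<^sub>R b + s *\<^sub>R a) - f (x + s *\<^sub>R a)) has_real_derivative
          ?d (x + h *\<^sub>R b + s *\<^sub>R a) - ?d (x + s *\<^sub>R a)) (at s)"
        by (intro DERIV_diff along fd)
    qed
    then obtain s where s: "0 < s" "s < h" and
      1: "f (x + h *\<^sub>R b + h *\<^sub>R a) - f (x + h *\<^sub>R a) - (f (x + h *\<^sub>R b) - f x)
        = h * (?d (x + h *\<^sub>R b + s *\<^sub>R a) - ?d (x + s *\<^sub>R a))"
      by auto
    have "\<exists>t. 0 < t \<and> t < h \<and> ?d (x + s *\<^sub>R a + h *\<^sub>R b) - ?d (x + s *\<^sub>R a + 0 *\<^sub>R b)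
        = (h - 0) * D a b (x + s *\<^sub>R a + t *\<^sub>R b)"
      unfolding D_def
      by (rule MVT2[OF h]) (use s inS in \<open>auto intro!: along fdd\<close>)
    then obtain t where t: "0 < t" "t < h" and
      2: "?d (x + s *\<^sub>R a + h *\<^sub>R b) - ?d (x + s *\<^sub>R a) = h * D a b (x + s *\<^sub>R a + t *\<^sub>R b)"
      by auto
    have "dist (x + s *\<^sub>R a + t *\<^sub>R b) x < \<rho>"
      using s t ab by (intro near) auto
    then show ?thesis
      using 1 2 by (intro exI[of _ "x + s *\<^sub>R a + t *\<^sub>R b"]) (simp add: add_ac)
  qed
  obtain y where y: "dist y x < \<rho>"
    "f (x + h *\<^sub>R u + h *\<^sub>R v) - f (x + h *\<^sub>R u) - (f (x + h *\<^sub>R v) - f x) = h * (h * D u v y)"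
    using mvt[of u v] by auto
  obtain z where z: "dist z x < \<rho>"
    "f (x + h *\<^sub>R v + h *\<^sub>R u) - f (x + h *\<^sub>R v) - (f (x + h *\<^sub>R u) - f x) = h * (h * D v u z)"
    using mvt[of v u] by auto
  have "h * (h * D u v y) = h * (h * D v u z)"
    unfolding y(2)[symmetric] z(2)[symmetric] by (simp add: add_ac)
  then have "D u v y = D v u z"
    using h by simp
  moreover have "dist (D u v y) (D u v x) < e" "dist (D v u z) (D v u x) < e"
    using r y(1) z(1) by (auto simp: \<rho>_def)
  ultimately show False
    using e(2) by (smt (verit) dist_commute dist_triangle)
qed

text \<open>Inner products with basis vectors commute with both derivatives, which reduces the claim
  to real components.\<close>

lemma symmetric_second_derivative:
  fixes f :: "'a::euclidean_space \<Rightarrow> 'b::euclidean_space"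
  assumes S: "open S" "x \<in> S" and f: "C_k_on 2 S f"
  shows "frechet_derivative (\<lambda>y. frechet_derivative f (at y) u) (at x) v =
         frechet_derivative (\<lambda>y. frechet_derivative f (at y) v) (at x) u"
proof (rule euclidean_eqI)
  fix b :: 'b assume "b \<in> Basis"
  have comp: "frechet_derivative (\<lambda>y. F y \<bullet> b) (at y) w = frechet_derivative F (at y) w \<bullet> b"
    if "F differentiable (at y)" for F :: "'a \<Rightarrow> 'b" and y w
    by (subst frechet_derivative_eqI[OF has_derivative_inner_left[OF has_derivative_frechet[OF that]]]) simp
  have fd: "f differentiable (at y)" and fdd: "(\<lambda>y. frechet_derivative f (at y) w) differentiable (at y)"
    if "y \<in> S" for y w
    using f that by (auto simp: numeral_2_eq_2)
  have "frechet_derivative (\<lambda>y. frechet_derivative (\<lambda>y. f y \<bullet> b) (at y) a) (at x) c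
      = frechet_derivative (\<lambda>y. frechet_derivative f (at y) a) (at x) c \<bullet> b" for a c
  proof -
    have "frechet_derivative (\<lambda>y. frechet_derivative f (at y) a \<bullet> b) (at x) =
        frechet_derivative (\<lambda>y. frechet_derivative (\<lambda>y. f y \<bullet> b) (at y) a) (at x)"
      using S fd fdd comp
      by (intro frechet_derivative_transform_within_open[of _ x S])
         (auto intro: differentiable_inner differentiable_const)
    then show ?thesis
      using comp[OF fdd[OF S(2)]] by metis
  qed
  moreover have "C_k_on 2 S (\<lambda>y. f y \<bullet> b)"
    by (rule C_k_on_linear_compose[OF S(1) bounded_linear_inner_left f])
  ultimately show "frechet_derivative (\<lambda>y. frechet_derivative f (at y) u) (at x) v \<bullet> b =
      frechet_derivative (\<lambda>y. frechet_derivative f (at y) v) (at x) u \<bullet> b"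
    using symmetric_second_derivative_real[OF S] by metis
qed

section \<open>Closure properties of smooth maps\<close>

lemma smooth_on_cong:
  "open S \<Longrightarrow> (\<And>x. x \<in> S \<Longrightarrow> f x = g x) \<Longrightarrow> smooth_on S f \<Longrightarrow> smooth_on S g"
  unfolding smooth_on_def using C_k_on_cong by blast

lemma smooth_on_subset: "smooth_on S f \<Longrightarrow> T \<subseteq> S \<Longrightarrow> smooth_on T f"
  unfolding smooth_on_def using C_k_on_subset by blast

lemma smooth_on_local:
  "(\<And>x. x \<in> S \<Longrightarrow> \<exists>T. open T \<and> x \<in> T \<and> smooth_on T f) \<Longrightarrow> smooth_on S f"
  unfolding smooth_on_def by (meson C_k_on_local)

lemma smooth_on_const [intro]: "smooth_on S (\<lambda>x. c)"
  by (simp add: smooth_on_def C_k_on_const)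

lemma smooth_on_add [intro]:
  "open S \<Longrightarrow> smooth_on S f \<Longrightarrow> smooth_on S g \<Longrightarrow> smooth_on S (\<lambda>x. f x + g x)"
  by (simp add: smooth_on_def C_k_on_add)

lemma smooth_on_sum:
  "open S \<Longrightarrow> (\<And>i. i \<in> I \<Longrightarrow> smooth_on S (f i)) \<Longrightarrow> smooth_on S (\<lambda>x. \<Sum>i\<in>I. f i x)"
  by (induction I rule: infinite_finite_induct) auto

lemma smooth_on_linear_compose:
  "open S \<Longrightarrow> bounded_linear L \<Longrightarrow> smooth_on S f \<Longrightarrow> smooth_on S (\<lambda>x. L (f x))"
  by (simp add: smooth_on_def C_k_on_linear_compose)

lemma smooth_on_diff [intro]:
  assumes "open S" "smooth_on S f" "smooth_on S g" shows "smooth_on S (\<lambda>x. f x - g x)"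
  using smooth_on_add[OF assms(1,2) smooth_on_linear_compose[OF assms(1) bounded_linear_minus[OF bounded_linear_ident] assms(3)]]
  by simp

lemma smooth_on_bounded_linear: "bounded_linear L \<Longrightarrow> smooth_on S L"
  by (simp add: smooth_on_def C_k_on_bounded_linear)

lemma smooth_on_bilinear:
  "open S \<Longrightarrow> bounded_bilinear B \<Longrightarrow> smooth_on S f \<Longrightarrow> smooth_on S g \<Longrightarrow> smooth_on S (\<lambda>x. B (f x) (g x))"
  by (simp add: smooth_on_def C_k_on_bilinear)

lemma smooth_on_affine_compose:
  "bounded_linear L \<Longrightarrow> (\<And>x. g x = a + L x) \<Longrightarrow> open S \<Longrightarrow> smooth_on S f \<Longrightarrow>
    smooth_on (g -` S) (\<lambda>x. f (g x))"
  unfolding smooth_on_def using C_k_on_affine_compose by blast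

lemma smooth_on_differentiable: "smooth_on S f \<Longrightarrow> x \<in> S \<Longrightarrow> f differentiable (at x)"
  unfolding smooth_on_def by (metis C_k_on.simps(2))

lemma smooth_on_derivative: "smooth_on S f \<Longrightarrow> smooth_on S (\<lambda>x. frechet_derivative f (at x) \<xi>)"
  unfolding smooth_on_def by (metis C_k_on.simps(2))

text \<open>\<open>smooth_on_derivative\<close> handles only a fixed direction; expanding
  \<open>w x\<close> in the standard basis reduces the variable direction to finitely many fixed
  ones with smooth coefficients.\<close>

lemma smooth_on_directional:
  fixes f :: "'a::euclidean_space \<Rightarrow> 'b::real_normed_vector"
  assumes S: "open S" and f: "smooth_on S f" and w: "smooth_on S w"
  shows "smooth_on S (\<lambda>x. frechet_derivative f (at x) (w x))"
proof (rule smooth_on_cong[OF S])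
  show "smooth_on S (\<lambda>x. \<Sum>b\<in>Basis. (w x \<bullet> b) *\<^sub>R frechet_derivative f (at x) b)"
    by (intro smooth_on_sum S smooth_on_bilinear[OF S bounded_bilinear_scaleR]
        smooth_on_linear_compose[OF S bounded_linear_inner_left w] smooth_on_derivative f)
  fix x assume "x \<in> S"
  then have lin: "linear (frechet_derivative f (at x))"
    using f smooth_on_differentiable linear_frechet_derivative by blast
  have "frechet_derivative f (at x) (w x) = frechet_derivative f (at x) (\<Sum>b\<in>Basis. (w x \<bullet> b) *\<^sub>R b)"
    by (simp add: euclidean_representation)
  then show "(\<Sum>b\<in>Basis. (w x \<bullet> b) *\<^sub>R frechet_derivative f (at x) b) = frechet_derivative f (at x) (w x)"
    by (simp add: linear_sum[OF lin] linear_cmul[OF lin])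
qed

section \<open>The Lie algebra and the group\<close>

lemma n_bracket_eq:
  "n_bracket x y = (0, cross3 (fst (fst x)) (fst (fst y)) + cross3 (snd (fst x)) (snd (fst y)))"
  using n_bracket_cross[of "fst (fst x)" "snd (fst x)" "snd x" "fst (fst y)" "snd (fst y)" "snd y"]
  by simp

lemma j_map_eq: "j_map C V = (cross3 C (fst V), cross3 C (snd V))"
  using j_map_cross[of C "fst V" "snd V"] by simp

lemma bounded_bilinear_n_bracket: "bounded_bilinear n_bracket"
  unfolding bilinear_conv_bounded_bilinear[symmetric] bilinear_def
  by (auto intro!: linearI simp: n_bracket_eq cross_add_left cross_add_right cross_mult_left
      cross_mult_right scaleR_add_right)

interpretation n_bracket: bounded_bilinear n_bracket
  by (rule bounded_bilinear_n_bracket)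

lemma n_bracket_flip: "n_bracket x y = - n_bracket y x"
  by (simp add: n_bracket_eq cross_skew[of "fst (fst y)" "fst (fst x)"]
      cross_skew[of "snd (fst y)" "snd (fst x)"])

lemma n_bracket_self [simp]: "n_bracket x x = 0"
  by (simp add: n_bracket_eq cross_refl zero_prod_def)

lemma n_bracket_central [simp]:
  "n_bracket (n_bracket x y) z = 0" "n_bracket x (n_bracket y z) = 0"
  by (simp_all add: n_bracket_eq zero_prod_def)

section \<open>Left-invariant fields and left translations\<close>

definition left_field :: "nil_n \<Rightarrow> nil_n \<Rightarrow> nil_n" where
  "left_field v x = v + (1/2) *\<^sub>R n_bracket x v"

text \<open>The Maurer-Cartan form: it left-translates a vector at \<open>x\<close> to the identity.
  Reversing the sign inverts \<open>left_field\<close> because nested brackets vanish.\<close>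

definition coframe :: "nil_n \<Rightarrow> nil_n \<Rightarrow> nil_n" where
  "coframe x v = v - (1/2) *\<^sub>R n_bracket x v"

lemma coframe_left_field [simp]: "coframe x (left_field v x) = v"
  by (simp add: coframe_def left_field_def n_bracket.add_right n_bracket.scaleR_right)

lemma left_field_coframe [simp]: "left_field (coframe x v) x = v"
  by (simp add: coframe_def left_field_def n_bracket.diff_right n_bracket.scaleR_right)

lemma left_field_0 [simp]: "left_field v 0 = v"
  by (simp add: left_field_def n_bracket.zero_left)

lemma bounded_linear_left_field: "bounded_linear (\<lambda>v. left_field v x)"
  unfolding left_field_def
  by (intro bounded_linear_add bounded_linear_ident bounded_linear_const_scaleR
      n_bracket.bounded_linear_right)

lemma left_field_add: "left_field (v + w) x = left_field v x + left_field w x"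
  and left_field_scaleR: "left_field (c *\<^sub>R v) x = c *\<^sub>R left_field v x"
  by (simp_all add: left_field_def n_bracket.add_right n_bracket.scaleR_right algebra_simps)

abbreviation translation :: "nil_n \<Rightarrow> nil_n \<Rightarrow> nil_n" where
  "translation a x \<equiv> a \<otimes>\<^bsub>nil_group\<^esub> x"

text \<open>This displays a left translation as an affine map whose linear part is
  \<open>left_field\<close> at \<open>a\<close>; its derivative and its smoothness are read off from
  here.\<close>

lemma translation_eq: "translation a x = a + left_field x a"
  by (simp add: mult_nil_group left_field_def)

lemma translation_minus [simp]:
  "translation (- a) (translation a x) = x" "translation a (translation (- a) x) = x"
  by (simp_all add: mult_nil_group n_bracket.add_right n_bracket.diff_right n_bracket.scaleR_right
      n_bracket.minus_left n_bracket.minus_right)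

lemma translation_assoc: "translation (translation a b) c = translation a (translation b c)"
  by (simp add: mult_nil_group n_bracket.add_right n_bracket.add_left n_bracket.scaleR_right
      n_bracket.scaleR_left algebra_simps)

lemma translation_minus_right [simp]: "translation x (- x) = 0" "translation (- x) x = 0"
  by (simp_all add: mult_nil_group n_bracket.minus_left n_bracket.minus_right)

lemma translation_0 [simp]: "translation 0 x = x" "translation x 0 = x"
  by (simp_all add: mult_nil_group n_bracket.zero_left n_bracket.zero_right)

lemma has_derivative_translation: "(translation a has_derivative (\<lambda>v. left_field v a)) (at x)"
  unfolding translation_eq
  using has_derivative_add[OF has_derivative_const bounded_linear_imp_has_derivative[OF bounded_linear_left_field]]
  by simp

text \<open>The derivative of a left translation carries a left-invariant field to itself. This is
  why the frame descends to the quotient.\<close>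

lemma left_field_translation: "left_field (left_field v x) a = left_field v (translation a x)"
  by (simp add: left_field_def mult_nil_group n_bracket.add_right n_bracket.add_left
      n_bracket.scaleR_left n_bracket.scaleR_right algebra_simps)

lemma continuous_on_translation [continuous_intros]:
  "continuous_on S f \<Longrightarrow> continuous_on S g \<Longrightarrow> continuous_on S (\<lambda>x. translation (f x) (g x))"
  unfolding mult_nil_group by (intro continuous_intros n_bracket.continuous_on)

lemma translation_vimage: "translation a -` S = translation (- a) ` S"
proof
  show "translation a -` S \<subseteq> translation (- a) ` S"
    by (metis image_eqI subsetI translation_minus(1) vimageD)
qed auto

lemma open_translation_image: "open S \<Longrightarrow> open (translation a ` S)"
  using translation_vimage[of "- a" S] open_vimage[of S "translation (- a)"]
  by (simp add: continuous_on_translation)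

lemma smooth_on_translation_compose:
  "open S \<Longrightarrow> smooth_on S f \<Longrightarrow> smooth_on (translation a -` S) (\<lambda>x. f (translation a x))"
  by (rule smooth_on_affine_compose[OF bounded_linear_left_field translation_eq])

text \<open>The Levi-Civita connection on left-invariant fields, given by the Koszul formula.\<close>

definition lc :: "nil_n \<Rightarrow> nil_n \<Rightarrow> nil_n" where
  "lc x y = (1/2) *\<^sub>R (n_bracket x y - (j_map (snd x) (fst y) + j_map (snd y) (fst x), 0))"

text \<open>\<open>nr\<close> is totally skew, and its component \<open>A \<times> B\<close> on \<open>\<zz>\<close> is chosen such that \<open>nr - lc\<close> is the
  diagonal action \<open>rot\<close> of \<open>\<zz> \<cong> so(3)\<close> on \<open>\<nn>\<close>, under which every tensor of \<open>\<nn>(j)\<close> is invariant.\<close>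

definition nr :: "nil_n \<Rightarrow> nil_n \<Rightarrow> nil_n" where
  "nr x y = (1/2) *\<^sub>R (n_bracket x y + (j_map (snd x) (fst y) - j_map (snd y) (fst x), 2 *\<^sub>R cross3 (snd x) (snd y)))"

definition rot :: "nil_n \<Rightarrow> nil_n \<Rightarrow> nil_n" where
  "rot x y = (j_map (snd x) (fst y), cross3 (snd x) (snd y))"

definition lc_curvature :: "nil_n \<Rightarrow> nil_n \<Rightarrow> nil_n \<Rightarrow> nil_n" where
  "lc_curvature x y z = lc x (lc y z) - lc y (lc x z) - lc (n_bracket x y) z"

lemma bounded_bilinear_lc: "bounded_bilinear lc"
  unfolding bilinear_conv_bounded_bilinear[symmetric] bilinear_def
  by (auto intro!: linearI simp: lc_def n_bracket_eq j_map_eq cross_add_left cross_add_right cross_mult_left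
      cross_mult_right algebra_simps)

interpretation lc: bounded_bilinear lc
  by (rule bounded_bilinear_lc)

lemma bounded_bilinear_nr: "bounded_bilinear nr"
  unfolding bilinear_conv_bounded_bilinear[symmetric] bilinear_def
  by (auto intro!: linearI simp: nr_def n_bracket_eq j_map_eq cross_add_left cross_add_right cross_mult_left
      cross_mult_right algebra_simps)

interpretation nr: bounded_bilinear nr
  by (rule bounded_bilinear_nr)

lemma lc_eq: "lc x y = nr x y - rot x y"
  by (simp add: lc_def nr_def rot_def n_bracket_eq j_map_eq scaleR_2 algebra_simps)

section \<open>Algebraic identities for connection, tensor and curvature\<close>

lemma lc_torsion_free: "lc x y - lc y x = n_bracket x y"
proof -
  have "lc x y - lc y x = (1/2) *\<^sub>R (n_bracket x y - n_bracket y x)"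
    by (simp add: lc_def algebra_simps)
  then show ?thesis
    by (simp add: n_bracket_flip[of y x])
qed

lemma lc_metric: "lc x y \<bullet> z + y \<bullet> lc x z = 0"
proof -
  \<comment> \<open>Pulling out the common factor 1/2 leaves a polynomial identity in the
    components.\<close>
  let ?B = "\<lambda>y. n_bracket x y - (j_map (snd x) (fst y) + j_map (snd y) (fst x), 0)"
  have "?B y \<bullet> z + y \<bullet> ?B z = 0"
    by (simp add: n_bracket_eq j_map_eq inner_prod_def cross3_def inner_vec_def sum_3 algebra_simps)
  moreover have "lc x y \<bullet> z + y \<bullet> lc x z = (1/2) * (?B y \<bullet> z + y \<bullet> ?B z)"
    unfolding lc_def inner_scaleR_left inner_scaleR_right distrib_left ..
  ultimately show ?thesis
    by simp
qed

lemma nr_metric: "nr x y \<bullet> z + y \<bullet> nr x z = 0"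
proof -
  let ?B = "\<lambda>y. n_bracket x y + (j_map (snd x) (fst y) - j_map (snd y) (fst x), 2 *\<^sub>R cross3 (snd x) (snd y))"
  have "?B y \<bullet> z + y \<bullet> ?B z = 0"
    by (simp add: n_bracket_eq j_map_eq inner_prod_def cross3_def inner_vec_def sum_3 algebra_simps)
  moreover have "nr x y \<bullet> z + y \<bullet> nr x z = (1/2) * (?B y \<bullet> z + y \<bullet> ?B z)"
    unfolding nr_def inner_scaleR_left inner_scaleR_right distrib_left ..
  ultimately show ?thesis
    by simp
qed

lemma nr_self: "nr x x = 0"
  by (simp add: nr_def cross_refl prod_eq_iff)

text \<open>This is the Jacobi identity of so(3). Bracket, \<open>lc\<close> and \<open>nr\<close>
  are all assembled from cross products, so it makes \<open>rot x\<close> a derivation of each of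
  them.\<close>

lemma cross3_derivation: "cross3 C (cross3 x y) = cross3 (cross3 C x) y + cross3 x (cross3 C y)"
  by (simp add: cross3_def vec_eq_iff forall_3 algebra_simps)

lemma rot_n_bracket: "rot x (n_bracket y z) = n_bracket (rot x y) z + n_bracket y (rot x z)"
  by (simp add: rot_def n_bracket_eq j_map_eq cross_add_right prod_eq_iff cross3_derivation[of "snd x"])

lemma rot_nr: "rot x (nr y z) = nr (rot x y) z + nr y (rot x z)"
  by (simp add: rot_def nr_def n_bracket_eq j_map_eq cross_add_right cross_mult_right Cross3.right_diff_distrib cross_minus_right cross3_derivation[of "snd x"] algebra_simps)

lemma rot_lc: "rot x (lc y z) = lc (rot x y) z + lc y (rot x z)"
  by (simp add: rot_def lc_def n_bracket_eq j_map_eq cross_add_right cross_mult_right Cross3.right_diff_distrib cross_minus_right cross3_derivation[of "snd x"] algebra_simps)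

lemma rot_linear: "rot x (y - z) = rot x y - rot x z" "rot x (y + z) = rot x y + rot x z"
  by (simp_all add: rot_def j_map_eq cross_add_right Cross3.right_diff_distrib)

lemma rot_lc_curvature:
  "rot v (lc_curvature x y z) = lc_curvature (rot v x) y z + lc_curvature x (rot v y) z + lc_curvature x y (rot v z)"
  by (simp add: lc_curvature_def rot_linear rot_lc rot_n_bracket lc.add_left lc.add_right algebra_simps)

text \<open>Substituting \<open>nr - rot\<close> for \<open>lc\<close> leaves three
  \<open>rot\<close> terms, which cancel by the derivation rule. This is condition (2) for constant
  coefficients.\<close>

lemma lc_nr_parallel:
  "lc x (nr y z) - nr (lc x y) z - nr y (lc x z) = nr x (nr y z) - nr y (nr x z) - nr (nr x y) z"
  by (simp add: lc_eq rot_nr nr.diff_left nr.diff_right algebra_simps)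

lemma lc_curvature_diff:
  "lc_curvature (x - x') y z = lc_curvature x y z - lc_curvature x' y z"
  "lc_curvature x (y - y') z = lc_curvature x y z - lc_curvature x y' z"
  "lc_curvature x y (z - z') = lc_curvature x y z - lc_curvature x y z'"
  by (simp_all add: lc_curvature_def lc.diff_left lc.diff_right n_bracket.diff_left n_bracket.diff_right algebra_simps)

text \<open>Condition (1) for constant coefficients: only the operator \<open>lc v\<close> is split,
  and its \<open>rot v\<close> part is a derivation of the curvature.\<close>

lemma lc_curvature_parallel:
  "lc v (lc_curvature x y z) - lc_curvature (lc v x) y z - lc_curvature x (lc v y) z - lc_curvature x y (lc v z) =
   nr v (lc_curvature x y z) - lc_curvature (nr v x) y z - lc_curvature x (nr v y) z - lc_curvature x y (nr v z)"
  by (simp add: lc_eq[of v] rot_lc_curvature lc_curvature_diff algebra_simps)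

section \<open>The quotient manifold\<close>

lemma Gamma_j_iff:
  "((L, R), C) \<in> Gamma_j \<longleftrightarrow> (\<forall>i. L $ i \<in> \<int> \<and> R $ i \<in> \<int> \<and> 2 * C $ i \<in> \<int>)"
  by (simp add: Gamma_j_def lattice_iff)

text \<open>The points are right cosets, so the fibres are orbits of left translations by the
  lattice; hence left-invariant objects descend.\<close>

lemma nil_proj_eq_iff: "nil_proj x = nil_proj y \<longleftrightarrow> (\<exists>a\<in>Gamma_j. y = translation a x)"
proof -
  interpret group nil_group by (rule group_nil_group)
  have coset: "Gamma_j #>\<^bsub>nil_group\<^esub> x \<in> rcosets\<^bsub>nil_group\<^esub> Gamma_j" for x
    by (rule rcosetsI) auto
  have "nil_proj x = nil_proj y \<longleftrightarrow> Gamma_j #>\<^bsub>nil_group\<^esub> x = Gamma_j #>\<^bsub>nil_group\<^esub> y"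
    by (simp add: nil_proj_def Abs_nilmanifold_inject coset)
  also have "\<dots> \<longleftrightarrow> y \<in> Gamma_j #>\<^bsub>nil_group\<^esub> x"
    using repr_independence[OF _ _ subgroup_Gamma_j, of y x] rcos_self[OF _ subgroup_Gamma_j, of y] by auto
  also have "\<dots> \<longleftrightarrow> (\<exists>a\<in>Gamma_j. y = translation a x)"
    by (auto simp: r_coset_def)
  finally show ?thesis .
qed

lemma nil_proj_translation: "a \<in> Gamma_j \<Longrightarrow> nil_proj (translation a x) = nil_proj x"
  using nil_proj_eq_iff[of x "translation a x"] by auto

lemma nil_proj_surj: "\<exists>x. p = nil_proj x"
proof -
  obtain x where "Rep_nilmanifold p = Gamma_j #>\<^bsub>nil_group\<^esub> x"
    using Rep_nilmanifold[of p] by (auto simp: RCOSETS_def)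
  then show ?thesis
    by (metis nil_proj_def Rep_nilmanifold_inverse)
qed

lemma nil_proj_some: "nil_proj (SOME x. nil_proj x = p) = p"
  by (rule someI_ex) (metis nil_proj_surj)

section \<open>Topology of the quotient\<close>

lemma open_nil_proj_vimage: "open U \<longleftrightarrow> open (nil_proj -` U)"
  by (fact open_nilmanifold_def)

lemma continuous_on_nil_proj: "continuous_on S nil_proj"
  using continuous_on_open_vimage[of UNIV nil_proj] open_nil_proj_vimage
  by (auto intro: continuous_on_subset)

lemma nil_proj_saturation: "nil_proj -` nil_proj ` S = (\<Union>a\<in>Gamma_j. translation a ` S)"
proof
  show "(\<Union>a\<in>Gamma_j. translation a ` S) \<subseteq> nil_proj -` nil_proj ` S"
    by (auto simp: nil_proj_translation)
  show "nil_proj -` nil_proj ` S \<subseteq> (\<Union>a\<in>Gamma_j. translation a ` S)"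
  proof
    fix y assume "y \<in> nil_proj -` nil_proj ` S"
    then obtain x where "x \<in> S" "nil_proj x = nil_proj y" by auto
    then show "y \<in> (\<Union>a\<in>Gamma_j. translation a ` S)"
      by (auto simp: nil_proj_eq_iff)
  qed
qed

lemma open_nil_proj_image: "open S \<Longrightarrow> open (nil_proj ` S)"
  by (auto simp: open_nil_proj_vimage[of "nil_proj ` S"] nil_proj_saturation intro: open_translation_image)

lemma closed_Gamma_j: "closed Gamma_j"
proof -
  have "Gamma_j = (\<Inter>i. (\<lambda>x. fst (fst x) $ i) -` \<int> \<inter> (\<lambda>x. snd (fst x) $ i) -` \<int> \<inter> (\<lambda>x. 2 * snd x $ i) -` \<int>)"
    by (auto simp: Gamma_j_iff)
  also have "closed \<dots>"
    by (intro closed_INT ballI closed_Int closed_vimage closed_Ints continuous_intros)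
  finally show ?thesis .
qed

text \<open>The radius 1/2 is the lattice spacing in the central directions: doubling a central
  coordinate gives an integer of absolute value below 1.\<close>

lemma Gamma_j_small:
  assumes a: "a \<in> Gamma_j" "norm a < 1/2" shows "a = 0"
proof -
  obtain L R C where LRC: "a = ((L, R), C)"
    by (metis surj_pair)
  have "norm (L, R) < 1/2" "norm C < 1/2"
    using a norm_fst_le[of "(L, R)" C] norm_snd_le[of C "(L, R)"] by (auto simp: LRC)
  moreover from this have "norm L < 1/2" "norm R < 1/2"
    using norm_fst_le[of L R] norm_snd_le[of R L] by auto
  ultimately have "\<bar>L $ i\<bar> < 1" "\<bar>R $ i\<bar> < 1" "\<bar>2 * C $ i\<bar> < 1" for i
    using component_le_norm_cart[of L i] component_le_norm_cart[of R i] component_le_norm_cart[of C i]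
    by auto
  moreover have "L $ i \<in> \<int>" "R $ i \<in> \<int>" "2 * C $ i \<in> \<int>" for i
    using a by (auto simp: LRC Gamma_j_iff)
  ultimately have "L $ i = 0" "R $ i = 0" "2 * C $ i = 0" for i
    using Ints_nonzero_abs_less1 by blast+
  then show ?thesis
    by (simp add: LRC vec_eq_iff prod_eq_iff)
qed

text \<open>The only group element translating \<open>u\<close> to \<open>v\<close> is
  \<open>translation v (- u)\<close>, and it depends continuously on both points. With a small ball
  for \<open>S\<close> this yields local injectivity of the projection; with the complement of the
  lattice it yields the Hausdorff property.\<close>

lemma open_translation_separation:
  assumes "open S" "translation y (- x) \<in> S"
  obtains U V where "open U" "open V" "x \<in> U" "y \<in> V" "\<And>u v. u \<in> U \<Longrightarrow> v \<in> V \<Longrightarrow> translation v (- u) \<in> S"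
proof -
  have "open ((\<lambda>z. translation (snd z) (- fst z)) -` S)"
    using assms(1) by (intro open_vimage continuous_intros)
  then obtain U V where "open U" "open V" "(x, y) \<in> U \<times> V" "U \<times> V \<subseteq> (\<lambda>z. translation (snd z) (- fst z)) -` S"
    using assms(2) by (elim open_prod_elim[of _ "(x, y)"]) auto
  then show thesis
    by (intro that[of U V]) auto
qed

lemma translation_eq_iff: "y = translation a x \<longleftrightarrow> translation y (- x) = a"
  by (metis translation_assoc translation_minus_right translation_0(2))

lemma inj_on_nil_proj_nbhd: obtains W where "open W" "x \<in> W" "inj_on nil_proj W"
proof -
  have "translation x (- x) \<in> ball 0 (1/2)" by simp
  then obtain U V where UV: "open U" "open V" "x \<in> U" "x \<in> V"
    "\<And>u v. u \<in> U \<Longrightarrow> v \<in> V \<Longrightarrow> translation v (- u) \<in> ball 0 (1/2)"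
    using open_translation_separation[OF open_ball] by metis
  have "inj_on nil_proj (U \<inter> V)"
  proof (rule inj_onI)
    fix u v assume "u \<in> U \<inter> V" "v \<in> U \<inter> V" "nil_proj u = nil_proj v"
    then obtain a where a: "a \<in> Gamma_j" "v = translation a u"
      by (auto simp: nil_proj_eq_iff)
    then have "a = translation v (- u)"
      using translation_eq_iff by metis
    then have "a = 0"
      using UV(5)[of u v] a \<open>u \<in> U \<inter> V\<close> \<open>v \<in> U \<inter> V\<close> by (intro Gamma_j_small) auto
    then show "u = v"
      using a by simp
  qed
  then show thesis
    using UV that[of "U \<inter> V"] by auto
qed

lemma Hausdorff_nilmanifold: "Hausdorff_space (euclidean :: nilmanifold topology)"
  unfolding Hausdorff_space_def
proof (intro allI impI, elim conjE)
  fix p q :: nilmanifold assume "p \<noteq> q"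
  obtain x y where xy: "p = nil_proj x" "q = nil_proj y"
    using nil_proj_surj by metis
  have "translation y (- x) \<in> - Gamma_j"
    using \<open>p \<noteq> q\<close> translation_eq_iff by (auto simp: xy nil_proj_eq_iff)
  moreover have "open (- Gamma_j)"
    using closed_Gamma_j by auto
  ultimately obtain U V where UV: "open U" "open V" "x \<in> U" "y \<in> V"
    "\<And>u v. u \<in> U \<Longrightarrow> v \<in> V \<Longrightarrow> translation v (- u) \<in> - Gamma_j"
    using open_translation_separation by metis
  have "disjnt (nil_proj ` U) (nil_proj ` V)"
    unfolding disjnt_iff
  proof (intro allI notI, elim conjE imageE)
    fix r u v assume "r = nil_proj u" "r = nil_proj v" "u \<in> U" "v \<in> V"
    then obtain a where "a \<in> Gamma_j" "v = translation a u"
      using nil_proj_eq_iff[of u v] by auto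
    moreover have "translation v (- u) \<in> - Gamma_j"
      using UV(5) \<open>u \<in> U\<close> \<open>v \<in> V\<close> .
    ultimately show False
      using translation_eq_iff by auto
  qed
  then show "\<exists>U V. openin euclidean U \<and> openin euclidean V \<and> p \<in> U \<and> q \<in> V \<and> disjnt U V"
    using UV(1-4) open_nil_proj_image unfolding xy open_openin[symmetric] by blast
qed

text \<open>The projection is an open continuous surjection, so the images of a countable basis form
  a basis.\<close>

lemma second_countable_nilmanifold: "second_countable (euclidean :: nilmanifold topology)"
proof -
  obtain B :: "nil_n set set" where B: "countable B" "topological_basis B"
    using ex_countable_basis by blast
  show ?thesis
    unfolding second_countable_def
  proof (intro exI[of _ "(`) nil_proj ` B"] conjI ballI allI impI)
    show "openin euclidean V" if "V \<in> (`) nil_proj ` B" for V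
      using that B(2) by (auto intro: open_nil_proj_image topological_basis_open)
    fix U :: "nilmanifold set" and p assume "openin euclidean U \<and> p \<in> U"
    moreover obtain x where "p = nil_proj x" using nil_proj_surj by blast
    ultimately obtain V where "V \<in> B" "x \<in> V" "V \<subseteq> nil_proj -` U"
      using topological_basisE[OF B(2), of "nil_proj -` U" x] open_nil_proj_vimage by auto
    then show "\<exists>V\<in>(`) nil_proj ` B. p \<in> V \<and> V \<subseteq> U"
      using \<open>p = nil_proj x\<close> by (intro bexI[of _ "nil_proj ` V"]) auto
  qed (use B in auto)
qed

text \<open>Rounding down coordinates by lattice translations moves every point into a unit cube,
  whose image is compact.\<close>

lemma compact_nilmanifold: "compact (UNIV :: nilmanifold set)"
proof -
  let ?I = "cbox 0 1 :: (real^3) set"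
  have "p \<in> nil_proj ` ((?I \<times> ?I) \<times> ?I)" for p
  proof -
    define fl :: "real^3 \<Rightarrow> real^3" where "fl x = (\<chi> i. of_int \<lfloor>x $ i\<rfloor>)" for x
    have fl_int: "fl x $ i \<in> \<int>" and fl_box: "x - fl x \<in> ?I" for x i
      by (auto simp: fl_def mem_box_cart) linarith
    obtain x where p: "p = nil_proj x" using nil_proj_surj by blast
    obtain L R C where x: "x = ((L, R), C)" by (metis surj_pair)
    define a :: nil_n where "a = ((- fl L, - fl R), 0)"
    \<comment> \<open>Translating by \<open>a\<close> also shifts the centre by half a bracket, so
      the central coordinates are rounded only afterwards; \<open>b\<close> is central and leaves
      the other coordinates alone.\<close>
    define C' where "C' = snd (translation a x)"
    define b :: nil_n where "b = ((0, 0), - fl C')"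
    have "a \<in> Gamma_j" "b \<in> Gamma_j"
      by (auto simp: a_def b_def Gamma_j_iff fl_int)
    then have "p = nil_proj (translation b (translation a x))"
      by (simp add: p nil_proj_translation)
    moreover have "translation a x = ((L - fl L, R - fl R), C')"
      by (simp add: C'_def a_def x mult_nil_group_cross)
    then have "translation b (translation a x) = ((L - fl L, R - fl R), C' - fl C')"
      by (simp add: b_def mult_nil_group_cross)
    ultimately show ?thesis
      using fl_box by auto
  qed
  moreover have "compact (nil_proj ` ((?I \<times> ?I) \<times> ?I))"
    by (intro compact_continuous_image continuous_on_nil_proj compact_Times compact_cbox)
  ultimately show ?thesis
    by (metis UNIV_eq_I)
qed

section \<open>Charts and smooth functions on the quotient\<close>

lemma inv_into_nil_proj:
  assumes "inj_on nil_proj W" "a \<in> Gamma_j" "translation a x \<in> W"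
  shows "inv_into W nil_proj (nil_proj x) = translation a x"
  using inv_into_f_f[OF assms(1,3)] nil_proj_translation[OF assms(2)] by simp

lemma inv_into_chart:
  assumes "inj_on nil_proj W" "x \<in> W"
  shows "inv_into (nil_proj ` W) (inv_into W nil_proj) x = nil_proj x"
  using inv_into_inv_into_eq[OF _ assms(2)] assms(1) by (auto simp: bij_betw_def)

lemma chart_image:
  assumes "inj_on nil_proj W"
  shows "inv_into W nil_proj ` (nil_proj ` W \<inter> V) = W \<inter> nil_proj -` V"
  using assms by (force simp: image_iff)

lemma is_chart_nil_proj:
  assumes "open W" "inj_on nil_proj W"
  shows "is_chart (nil_proj ` W, inv_into W nil_proj)"
proof -
  have im: "inv_into W nil_proj ` nil_proj ` W = W"
    using chart_image[OF assms(2), of UNIV] by simp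
  have cont: "continuous_on (nil_proj ` W) (inv_into W nil_proj)"
  proof (subst continuous_on_open_vimage[OF open_nil_proj_image[OF assms(1)]], intro allI impI)
    fix B :: "nil_n set" assume "open B"
    \<comment> \<open>Continuity of the local inverse thus reduces to openness of the
      projection.\<close>
    have "inv_into W nil_proj -` B \<inter> nil_proj ` W = nil_proj ` (W \<inter> B)"
      using assms(2) by (auto simp: image_iff)
    then show "open (inv_into W nil_proj -` B \<inter> nil_proj ` W)"
      using \<open>open B\<close> assms(1) by (simp add: open_nil_proj_image open_Int)
  qed
  have "continuous_on W (inv_into (nil_proj ` W) (inv_into W nil_proj))"
    using continuous_on_nil_proj inv_into_chart[OF assms(2)] by (auto cong: continuous_on_cong)
  then have "homeomorphism (nil_proj ` W) W (inv_into W nil_proj) (inv_into (nil_proj ` W) (inv_into W nil_proj))"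
    using cont im assms(2) inv_into_chart[OF assms(2)] by (intro homeomorphismI) (auto simp: image_iff)
  then show ?thesis
    using assms by (simp add: is_chart_def im open_nil_proj_image)
qed

lemma smooth_on_translation: "open S \<Longrightarrow> smooth_on S (translation a)"
  unfolding translation_eq
  by (intro smooth_on_add smooth_on_const smooth_on_bounded_linear bounded_linear_left_field)

lemma smooth_on_local_coordinate:
  assumes "open W" "inj_on nil_proj W"
  shows "smooth_on (nil_proj -` nil_proj ` W) (\<lambda>x. inv_into W nil_proj (nil_proj x))"
proof (rule smooth_on_local)
  fix x assume "x \<in> nil_proj -` nil_proj ` W"
  then obtain y where "y \<in> W" "nil_proj x = nil_proj y"
    by blast
  then obtain a where a: "a \<in> Gamma_j" "translation a x \<in> W"
    using nil_proj_eq_iff[of x y] by blast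
  have op: "open (translation a -` W)"
    using assms(1) by (intro open_vimage continuous_intros)
  have "smooth_on (translation a -` W) (translation a)"
    by (rule smooth_on_translation[OF op])
  then have "smooth_on (translation a -` W) (\<lambda>x. inv_into W nil_proj (nil_proj x))"
    using a(1) assms(2) by (elim smooth_on_cong[OF op, rotated]) (simp add: inv_into_nil_proj)
  then show "\<exists>T. open T \<and> x \<in> T \<and> smooth_on T (\<lambda>x. inv_into W nil_proj (nil_proj x))"
    using op a by blast
qed

lemma smooth_manifold_nilmanifold: "smooth_manifold nilmanifold_atlas"
  unfolding smooth_manifold_def
proof (intro conjI Hausdorff_nilmanifold second_countable_nilmanifold)
  show "\<forall>c\<in>nilmanifold_atlas. is_chart c"
    by (auto simp: nilmanifold_atlas_def is_chart_nil_proj)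
  have "p \<in> (\<Union>(U, \<phi>)\<in>nilmanifold_atlas. U)" for p
  proof -
    obtain x where "p = nil_proj x" using nil_proj_surj by blast
    obtain W where "open W" "x \<in> W" "inj_on nil_proj W"
      using inj_on_nil_proj_nbhd .
    then have "(nil_proj ` W, inv_into W nil_proj) \<in> nilmanifold_atlas" "p \<in> nil_proj ` W"
      using \<open>p = nil_proj x\<close> by (auto simp: nilmanifold_atlas_def)
    then show ?thesis by blast
  qed
  then show "(\<Union>(U, \<phi>)\<in>nilmanifold_atlas. U) = UNIV"
    by blast
  have "smooth_on (inv_into W nil_proj ` (nil_proj ` W \<inter> nil_proj ` W'))
      (inv_into W' nil_proj \<circ> inv_into (nil_proj ` W) (inv_into W nil_proj))"
    if "open W" "inj_on nil_proj W" "open W'" "inj_on nil_proj W'" for W W'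
    unfolding chart_image[OF that(2)]
  proof (rule smooth_on_cong)
    show "smooth_on (W \<inter> nil_proj -` nil_proj ` W') (\<lambda>x. inv_into W' nil_proj (nil_proj x))"
      using smooth_on_local_coordinate[OF that(3,4)] by (rule smooth_on_subset) auto
    show "open (W \<inter> nil_proj -` nil_proj ` W')"
      using that open_nil_proj_image open_nil_proj_vimage by blast
  qed (use that in \<open>auto simp: inv_into_chart\<close>)
  then show "\<forall>(U, \<phi>)\<in>nilmanifold_atlas. \<forall>(V, \<psi>)\<in>nilmanifold_atlas.
      smooth_on (\<phi> ` (U \<inter> V)) (\<psi> \<circ> inv_into U \<phi>)"
    by (auto simp: nilmanifold_atlas_def)
qed

text \<open>The charts are local inverses of the projection, so smoothness can be tested on the
  pullback to the vector space; after this lemma charts rarely appear.\<close>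

lemma smooth_fun_on_iff:
  assumes "open V"
  shows "smooth_fun_on nilmanifold_atlas V f \<longleftrightarrow> smooth_on (nil_proj -` V) (\<lambda>x. f (nil_proj x))"
proof
  have chart: "smooth_on (inv_into W nil_proj ` (nil_proj ` W \<inter> V)) (f \<circ> inv_into (nil_proj ` W) (inv_into W nil_proj))
      \<longleftrightarrow> smooth_on (W \<inter> nil_proj -` V) (\<lambda>x. f (nil_proj x))" (is "smooth_on _ ?g \<longleftrightarrow> smooth_on _ ?h")
    if "open W" "inj_on nil_proj W" for W
  proof -
    have "open (W \<inter> nil_proj -` V)"
      using that assms open_nil_proj_vimage by blast
    moreover have "?g x = ?h x" if "x \<in> W \<inter> nil_proj -` V" for x
      using that \<open>inj_on nil_proj W\<close> by (simp add: inv_into_chart)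
    ultimately show ?thesis
      unfolding chart_image[OF that(2)]
      using smooth_on_cong[of _ ?g ?h] smooth_on_cong[of _ ?h ?g] by (metis (no_types, lifting))
  qed
  {
    assume *: "smooth_fun_on nilmanifold_atlas V f"
    show "smooth_on (nil_proj -` V) (\<lambda>x. f (nil_proj x))"
    proof (rule smooth_on_local)
      fix x assume x: "x \<in> nil_proj -` V"
      obtain W where W: "open W" "x \<in> W" "inj_on nil_proj W"
        using inj_on_nil_proj_nbhd .
      then have "(nil_proj ` W, inv_into W nil_proj) \<in> nilmanifold_atlas"
        by (auto simp: nilmanifold_atlas_def)
      then have "smooth_on (W \<inter> nil_proj -` V) (\<lambda>x. f (nil_proj x))"
        using * chart[OF W(1,3)] by (fastforce simp: smooth_fun_on_def)
      then show "\<exists>T. open T \<and> x \<in> T \<and> smooth_on T (\<lambda>x. f (nil_proj x))"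
        using W x assms open_nil_proj_vimage by (intro exI[of _ "W \<inter> nil_proj -` V"]) auto
    qed
  next
    assume *: "smooth_on (nil_proj -` V) (\<lambda>x. f (nil_proj x))"
    have "smooth_on (W \<inter> nil_proj -` V) (\<lambda>x. f (nil_proj x))" for W
      using * by (rule smooth_on_subset) auto
    then show "smooth_fun_on nilmanifold_atlas V f"
      unfolding smooth_fun_on_def nilmanifold_atlas_def using chart by auto
  }
qed

section \<open>Vector fields in the left-invariant frame\<close>

text \<open>\<open>\<xi>\<close> lists the coefficients of a vector field in the frame induced by the left-invariant fields.\<close>

definition deriv_along ::
    "(nilmanifold \<Rightarrow> nil_n) \<Rightarrow> (nilmanifold \<Rightarrow> 'b::real_normed_vector) \<Rightarrow> nilmanifold \<Rightarrow> 'b" where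
  "deriv_along \<xi> h p = (let x = SOME x. nil_proj x = p in
     frechet_derivative (\<lambda>x. h (nil_proj x)) (at x) (left_field (\<xi> p) x))"

text \<open>The default 0 repeats that of \<open>coord_vector\<close>, so that frame vectors are
  literally elements of the tangent space.\<close>

definition frame :: "nilmanifold \<Rightarrow> nil_n \<Rightarrow> nilmanifold tangent" where
  "frame p v = (\<lambda>f. if smooth_near nilmanifold_atlas p f then deriv_along (\<lambda>_. v) f p else 0)"

definition field :: "(nilmanifold \<Rightarrow> nil_n) \<Rightarrow> nilmanifold vfield" where
  "field \<xi> = (\<lambda>p. frame p (\<xi> p))"

definition smooth_map :: "(nilmanifold \<Rightarrow> 'b::real_normed_vector) \<Rightarrow> bool" where
  "smooth_map h \<longleftrightarrow> smooth_on UNIV (\<lambda>x. h (nil_proj x))"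

text \<open>Two points of a fibre differ by a lattice translation, which preserves both the pulled
  back function and the left-invariant field; so the derivative may be computed at any point of the
  fibre.\<close>

lemma deriv_along_eqI:
  assumes "((\<lambda>x. h (nil_proj x)) has_derivative h') (at x)"
  shows "deriv_along \<xi> h (nil_proj x) = h' (left_field (\<xi> (nil_proj x)) x)"
proof -
  define y where "y = (SOME y. nil_proj y = nil_proj x)"
  have "nil_proj y = nil_proj x"
    unfolding y_def by (rule nil_proj_some)
  then obtain a where a: "a \<in> Gamma_j" "x = translation a y"
    using nil_proj_eq_iff[of y x] by blast
  have "((\<lambda>y. h (nil_proj (translation a y))) has_derivative (\<lambda>v. h' (left_field v a))) (at y)"
    using has_derivative_compose[OF has_derivative_translation, of "\<lambda>x. h (nil_proj x)" h' a y] assms a(2)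
    by simp
  then have "((\<lambda>y. h (nil_proj y)) has_derivative (\<lambda>v. h' (left_field v a))) (at y)"
    by (simp add: nil_proj_translation[OF a(1)])
  then have "frechet_derivative (\<lambda>y. h (nil_proj y)) (at y) (left_field v y) = h' (left_field v x)" for v
    using frechet_derivative_eqI by (metis a(2) left_field_translation)
  then show ?thesis
    by (simp add: deriv_along_def Let_def flip: y_def)
qed

lemma deriv_along_eq:
  "(\<lambda>x. h (nil_proj x)) differentiable (at x) \<Longrightarrow>
    deriv_along \<xi> h (nil_proj x) = frechet_derivative (\<lambda>x. h (nil_proj x)) (at x) (left_field (\<xi> (nil_proj x)) x)"
  by (rule deriv_along_eqI[OF has_derivative_frechet])

lemma smooth_near_iff:
  "smooth_near nilmanifold_atlas (nil_proj x) f \<longleftrightarrow>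
    (\<exists>W. open W \<and> nil_proj x \<in> W \<and> smooth_on (nil_proj -` W) (\<lambda>x. f (nil_proj x)))"
  unfolding smooth_near_def using smooth_fun_on_iff by blast

lemma smooth_near_open:
  "open W \<Longrightarrow> p \<in> W \<Longrightarrow> smooth_fun_on nilmanifold_atlas W f \<Longrightarrow> smooth_near nilmanifold_atlas p f"
  unfolding smooth_near_def by blast

lemma smooth_near_differentiable:
  "smooth_near nilmanifold_atlas (nil_proj x) f \<Longrightarrow> (\<lambda>x. f (nil_proj x)) differentiable (at x)"
  unfolding smooth_near_iff using smooth_on_differentiable by blast

lemma field_eq:
  "field \<xi> p f = (if smooth_near nilmanifold_atlas p f then deriv_along \<xi> f p else 0)"
  by (simp add: field_def frame_def deriv_along_def)

text \<open>The components of \<open>c\<close> are locally smooth test functions. Applying a tangent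
  vector to them recovers its coordinates, hence its frame coefficients.\<close>

lemma local_coordinates:
  obtains W c where "open W" "x \<in> W" "\<And>y. y \<in> W \<Longrightarrow> c (nil_proj y) = y"
    "\<And>b. smooth_fun_on nilmanifold_atlas (nil_proj ` W) (\<lambda>q. c q \<bullet> b)"
proof -
  obtain W where W: "open W" "x \<in> W" "inj_on nil_proj W"
    using inj_on_nil_proj_nbhd .
  have op: "open (nil_proj -` nil_proj ` W)"
    using W open_nil_proj_image open_nil_proj_vimage by blast
  have "smooth_on (nil_proj -` nil_proj ` W) (\<lambda>x. inv_into W nil_proj (nil_proj x) \<bullet> b)" for b
    by (rule smooth_on_linear_compose[OF op bounded_linear_inner_left smooth_on_local_coordinate[OF W(1,3)]])
  then show thesis
    using W by (intro that[of W "inv_into W nil_proj"]) (simp_all add: smooth_fun_on_iff open_nil_proj_image)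
qed

lemma deriv_along_coordinate:
  assumes "open W" "x \<in> W" "\<And>y. y \<in> W \<Longrightarrow> c (nil_proj y) = y"
  shows "deriv_along \<xi> (\<lambda>q. c q \<bullet> b) (nil_proj x) = left_field (\<xi> (nil_proj x)) x \<bullet> b"
proof (rule deriv_along_eqI[of _ "\<lambda>v. v \<bullet> b"])
  have "((\<lambda>y. y \<bullet> b) has_derivative (\<lambda>v. v \<bullet> b)) (at x)"
    by (rule bounded_linear_imp_has_derivative[OF bounded_linear_inner_left])
  then show "((\<lambda>y. c (nil_proj y) \<bullet> b) has_derivative (\<lambda>v. v \<bullet> b)) (at x)"
    by (rule has_derivative_transform_within_open[OF _ assms(1,2)]) (simp add: assms(3))
qed

lemma frame_linear: "frame p (a *\<^sub>R v + b *\<^sub>R w) = (\<lambda>f. a * frame p v f + b * frame p w f)"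
proof
  fix f
  obtain x where p: "p = nil_proj x" using nil_proj_surj by blast
  show "frame p (a *\<^sub>R v + b *\<^sub>R w) f = a * frame p v f + b * frame p w f"
  proof (cases "smooth_near nilmanifold_atlas p f")
    case True
    then have d: "(\<lambda>x. f (nil_proj x)) differentiable (at x)"
      by (simp add: p smooth_near_differentiable)
    then show ?thesis
      using True by (simp add: frame_def p deriv_along_eq left_field_add left_field_scaleR
          linear_add[OF linear_frechet_derivative] linear_cmul[OF linear_frechet_derivative])
  qed (simp add: frame_def)
qed

lemma frame_inject: "frame p v = frame p w \<longleftrightarrow> v = w"
proof
  assume eq: "frame p v = frame p w"
  obtain x where p: "p = nil_proj x" using nil_proj_surj by blast
  obtain W c where W: "open W" "x \<in> W" "\<And>y. y \<in> W \<Longrightarrow> c (nil_proj y) = y"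
    "\<And>b. smooth_fun_on nilmanifold_atlas (nil_proj ` W) (\<lambda>q. c q \<bullet> b)"
    by (rule local_coordinates[of x]) (rule that)
  have "smooth_near nilmanifold_atlas p (\<lambda>q. c q \<bullet> b)" for b
    using W by (intro smooth_near_open[OF open_nil_proj_image[OF W(1)]]) (auto simp: p)
  then have "left_field v x \<bullet> b = left_field w x \<bullet> b" for b
    using fun_cong[OF eq, of "\<lambda>q. c q \<bullet> b"] deriv_along_coordinate[OF W(1-3), where b=b]
    by (simp add: frame_def p)
  then have "left_field v x = left_field w x"
    by (metis vector_eq_rdot)
  then show "v = w"
    by (metis coframe_left_field)
qed simp

lemma coord_vector_nilmanifold:
  assumes "open W" "inj_on nil_proj W" "x \<in> W"
  shows "coord_vector nilmanifold_atlas (nil_proj ` W, inv_into W nil_proj) (nil_proj x) \<xi>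
    = frame (nil_proj x) (coframe x \<xi>)"
proof
  fix f :: "nilmanifold \<Rightarrow> real"
  let ?g = "f \<circ> inv_into (nil_proj ` W) (inv_into W nil_proj)"
  have "frechet_derivative ?g (at x) = frechet_derivative (\<lambda>x. f (nil_proj x)) (at x)"
    if "(\<lambda>x. f (nil_proj x)) differentiable (at x)"
    using frechet_derivative_transform_within_open[OF that assms(1,3), of ?g] inv_into_chart[OF assms(2)]
    by simp
  then show "coord_vector nilmanifold_atlas (nil_proj ` W, inv_into W nil_proj) (nil_proj x) \<xi> f
      = frame (nil_proj x) (coframe x \<xi>) f"
    using assms by (simp add: coord_vector_def frame_def deriv_along_eq smooth_near_differentiable)
qed

lemma tangent_space_nilmanifold: "tangent_space nilmanifold_atlas p = range (frame p)"
proof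
  show "tangent_space nilmanifold_atlas p \<subseteq> range (frame p)"
  proof
    fix u assume "u \<in> tangent_space nilmanifold_atlas p"
    then obtain W \<xi> where W: "open W" "inj_on nil_proj W" "p \<in> nil_proj ` W"
      "u = coord_vector nilmanifold_atlas (nil_proj ` W, inv_into W nil_proj) p \<xi>"
      by (auto simp: tangent_space_def nilmanifold_atlas_def)
    then show "u \<in> range (frame p)"
      using coord_vector_nilmanifold[OF W(1,2)] by blast
  qed
  show "range (frame p) \<subseteq> tangent_space nilmanifold_atlas p"
  proof
    fix u assume "u \<in> range (frame p)"
    then obtain v where v: "u = frame p v" by blast
    obtain x where p: "p = nil_proj x" using nil_proj_surj by blast
    obtain W where W: "open W" "x \<in> W" "inj_on nil_proj W"
      using inj_on_nil_proj_nbhd .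
    have "u = coord_vector nilmanifold_atlas (nil_proj ` W, inv_into W nil_proj) p (left_field v x)"
      using coord_vector_nilmanifold[OF W(1,3,2)] by (simp add: v p)
    moreover have "(nil_proj ` W, inv_into W nil_proj) \<in> nilmanifold_atlas" "p \<in> nil_proj ` W"
      using W by (auto simp: nilmanifold_atlas_def p)
    ultimately show "u \<in> tangent_space nilmanifold_atlas p"
      unfolding tangent_space_def by blast
  qed
qed

definition coeff :: "nilmanifold \<Rightarrow> nilmanifold tangent \<Rightarrow> nil_n" where
  "coeff p = the_inv (frame p)"

lemma coeff_frame [simp]: "coeff p (frame p v) = v"
  unfolding coeff_def by (rule the_inv_f_f) (simp add: inj_def frame_inject)

lemma frame_coeff: "u \<in> tangent_space nilmanifold_atlas p \<Longrightarrow> frame p (coeff p u) = u"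
  by (auto simp: tangent_space_nilmanifold)

lemma coeff_field [simp]: "coeff p (field \<xi> p) = \<xi> p"
  by (simp add: field_def)

lemma smooth_on_left_field:
  fixes v :: "nil_n \<Rightarrow> nil_n"
  assumes "open S" "smooth_on S v"
  shows "smooth_on S (\<lambda>x. left_field (v x) x)" and "smooth_on S (\<lambda>x. coframe x (v x))"
proof -
  have br: "smooth_on S (\<lambda>x. (1/2) *\<^sub>R n_bracket x (v x))"
    by (intro smooth_on_linear_compose[OF assms(1) bounded_linear_scaleR_right]
        smooth_on_bilinear[OF assms(1) bounded_bilinear_n_bracket] assms
        smooth_on_bounded_linear bounded_linear_ident)
  show "smooth_on S (\<lambda>x. left_field (v x) x)" "smooth_on S (\<lambda>x. coframe x (v x))"
    unfolding left_field_def coframe_def by (intro smooth_on_add smooth_on_diff assms br)+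
qed

lemma smooth_map_left_field:
  "smooth_map \<xi> \<Longrightarrow> open S \<Longrightarrow> smooth_on S (\<lambda>x. left_field (\<xi> (nil_proj x)) x)"
  unfolding smooth_map_def by (intro smooth_on_left_field(1)) (auto elim: smooth_on_subset)

lemma smooth_on_deriv_along:
  assumes "smooth_map \<xi>" "open S" "smooth_on S (\<lambda>x. h (nil_proj x))"
  shows "smooth_on S (\<lambda>x. deriv_along \<xi> h (nil_proj x))"
proof (rule smooth_on_cong[OF assms(2)])
  show "smooth_on S (\<lambda>x. frechet_derivative (\<lambda>x. h (nil_proj x)) (at x) (left_field (\<xi> (nil_proj x)) x))"
    by (intro smooth_on_directional assms smooth_map_left_field)
qed (simp add: deriv_along_eq smooth_on_differentiable[OF assms(3)])

text \<open>For the inclusion from left to right, a field applied to the local coordinate functions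
  gives smooth components of \<open>left_field\<close>, and \<open>coframe\<close> turns them into
  smooth frame coefficients.\<close>

lemma vector_fields_nilmanifold: "vector_fields nilmanifold_atlas = field ` {\<xi>. smooth_map \<xi>}"
proof
  show "field ` {\<xi>. smooth_map \<xi>} \<subseteq> vector_fields nilmanifold_atlas"
  proof (intro image_subsetI, unfold mem_Collect_eq)
    fix \<xi> :: "nilmanifold \<Rightarrow> nil_n" assume \<xi>: "smooth_map \<xi>"
    have "smooth_fun_on nilmanifold_atlas W (\<lambda>p. field \<xi> p f)"
      if "open W" "smooth_fun_on nilmanifold_atlas W f" for W and f :: "nilmanifold \<Rightarrow> real"
    proof -
      have op: "open (nil_proj -` W)"
        using that(1) open_nil_proj_vimage by blast
      have "smooth_on (nil_proj -` W) (\<lambda>x. deriv_along \<xi> f (nil_proj x))"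
        using that by (intro smooth_on_deriv_along \<xi> op) (simp add: smooth_fun_on_iff)
      then have "smooth_on (nil_proj -` W) (\<lambda>x. field \<xi> (nil_proj x) f)"
        by (rule smooth_on_cong[OF op, rotated]) (use that smooth_near_open in \<open>simp add: field_eq\<close>)
      then show ?thesis
        using that by (simp add: smooth_fun_on_iff)
    qed
    then show "field \<xi> \<in> vector_fields nilmanifold_atlas"
      by (simp add: vector_fields_def tangent_space_nilmanifold field_def)
  qed
  show "vector_fields nilmanifold_atlas \<subseteq> field ` {\<xi>. smooth_map \<xi>}"
  proof
    fix X assume X: "X \<in> vector_fields nilmanifold_atlas"
    define \<xi> where "\<xi> p = coeff p (X p)" for p
    have X_eq: "X = field \<xi>"
      using X by (auto simp: vector_fields_def field_def \<xi>_def frame_coeff)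
    have "smooth_on UNIV (\<lambda>x. \<xi> (nil_proj x))"
    proof (rule smooth_on_local)
      fix x :: nil_n
      obtain W c where W: "open W" "x \<in> W" "\<And>y. y \<in> W \<Longrightarrow> c (nil_proj y) = y"
        "\<And>b. smooth_fun_on nilmanifold_atlas (nil_proj ` W) (\<lambda>q. c q \<bullet> b)"
        by (rule local_coordinates[of x]) (rule that)
      have "smooth_on W (\<lambda>y. left_field (\<xi> (nil_proj y)) y \<bullet> b)" for b
      proof (rule smooth_on_cong[OF W(1)])
        have "smooth_fun_on nilmanifold_atlas (nil_proj ` W) (\<lambda>p. X p (\<lambda>q. c q \<bullet> b))"
          using X W(4) open_nil_proj_image[OF W(1)] unfolding vector_fields_def by blast
        then have "smooth_on (nil_proj -` nil_proj ` W) (\<lambda>y. X (nil_proj y) (\<lambda>q. c q \<bullet> b))"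
          by (simp add: smooth_fun_on_iff open_nil_proj_image W(1))
        then show "smooth_on W (\<lambda>y. X (nil_proj y) (\<lambda>q. c q \<bullet> b))"
          by (rule smooth_on_subset) blast
        fix y assume "y \<in> W"
        moreover from this have "smooth_near nilmanifold_atlas (nil_proj y) (\<lambda>q. c q \<bullet> b)"
          by (intro smooth_near_open[OF open_nil_proj_image[OF W(1)] _ W(4)]) blast
        ultimately show "X (nil_proj y) (\<lambda>q. c q \<bullet> b) = left_field (\<xi> (nil_proj y)) y \<bullet> b"
          using deriv_along_coordinate[OF W(1) _ W(3), of y \<xi> b] by (simp add: X_eq field_eq)
      qed
      then have "smooth_on W (\<lambda>y. \<Sum>b\<in>Basis. (left_field (\<xi> (nil_proj y)) y \<bullet> b) *\<^sub>R b)"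
        by (intro smooth_on_sum W(1) smooth_on_bilinear[OF W(1) bounded_bilinear_scaleR] smooth_on_const)
      then have "smooth_on W (\<lambda>y. left_field (\<xi> (nil_proj y)) y)"
        by (simp add: euclidean_representation)
      then have "smooth_on W (\<lambda>y. \<xi> (nil_proj y))"
        using smooth_on_left_field(2)[OF W(1)] by fastforce
      then show "\<exists>T. open T \<and> x \<in> T \<and> smooth_on T (\<lambda>x. \<xi> (nil_proj x))"
        using W(1,2) by blast
    qed
    then show "X \<in> field ` {\<xi>. smooth_map \<xi>}"
      using X_eq by (simp add: smooth_map_def)
  qed
qed

text \<open>Product rule for a derivative taken in a moving direction: one term differentiates with
  the direction frozen at \<open>b x\<close>, the other differentiates the direction. The basis
  expansion again reduces everything to fixed directions.\<close>

lemma has_derivative_directional: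
  fixes f :: "'a::euclidean_space \<Rightarrow> 'b::real_normed_vector"
  assumes S: "open S" "x \<in> S" and f: "smooth_on S f" and b: "(b has_derivative b') (at x)"
  shows "((\<lambda>y. frechet_derivative f (at y) (b y)) has_derivative
     (\<lambda>v. frechet_derivative (\<lambda>y. frechet_derivative f (at y) (b x)) (at x) v +
        frechet_derivative f (at x) (b' v))) (at x)"
proof -
  let ?D = "\<lambda>w y. frechet_derivative f (at y) w"
  have expand: "?D w y = (\<Sum>i\<in>Basis. (w \<bullet> i) *\<^sub>R ?D i y)" if "y \<in> S" for w y
  proof -
    have lin: "linear (\<lambda>w. ?D w y)"
      using smooth_on_differentiable[OF f that] by (simp add: linear_frechet_derivative)
    have "?D w y = ?D (\<Sum>i\<in>Basis. (w \<bullet> i) *\<^sub>R i) y"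
      by (simp add: euclidean_representation)
    then show ?thesis
      by (simp add: linear_sum[OF lin] linear_cmul[OF lin])
  qed
  have D: "(?D w has_derivative frechet_derivative (?D w) (at x)) (at x)" for w
    by (rule has_derivative_frechet[OF smooth_on_differentiable[OF smooth_on_derivative[OF f] S(2)]])
  have "((\<lambda>y. \<Sum>i\<in>Basis. (b x \<bullet> i) *\<^sub>R ?D i y) has_derivative
      (\<lambda>v. \<Sum>i\<in>Basis. (b x \<bullet> i) *\<^sub>R frechet_derivative (?D i) (at x) v)) (at x)"
    by (intro has_derivative_sum has_derivative_scaleR_right D)
  then have "(?D (b x) has_derivative (\<lambda>v. \<Sum>i\<in>Basis. (b x \<bullet> i) *\<^sub>R frechet_derivative (?D i) (at x) v)) (at x)"
    by (rule has_derivative_transform_within_open[OF _ S]) (simp add: expand[of _ "b x"])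
  then have fixed: "frechet_derivative (?D (b x)) (at x) v
      = (\<Sum>i\<in>Basis. (b x \<bullet> i) *\<^sub>R frechet_derivative (?D i) (at x) v)" for v
    by (simp add: frechet_derivative_eqI)
  have "((\<lambda>y. \<Sum>i\<in>Basis. (b y \<bullet> i) *\<^sub>R ?D i y) has_derivative
      (\<lambda>v. \<Sum>i\<in>Basis. (b x \<bullet> i) *\<^sub>R frechet_derivative (?D i) (at x) v + (b' v \<bullet> i) *\<^sub>R ?D i x)) (at x)"
    by (intro has_derivative_sum has_derivative_scaleR has_derivative_inner_left b D)
  then have "((\<lambda>y. ?D (b y) y) has_derivative
      (\<lambda>v. \<Sum>i\<in>Basis. (b x \<bullet> i) *\<^sub>R frechet_derivative (?D i) (at x) v + (b' v \<bullet> i) *\<^sub>R ?D i x)) (at x)"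
    by (rule has_derivative_transform_within_open[OF _ S]) (simp add: expand[symmetric])
  then show ?thesis
    by (simp only: sum.distrib fixed expand[OF S(2), of "b' v" for v])
qed

lemma has_derivative_left_field:
  assumes "(v has_derivative v') (at x)"
  shows "((\<lambda>y. left_field (v y) y) has_derivative
    (\<lambda>w. left_field (v' w) x + (1/2) *\<^sub>R n_bracket w (v x))) (at x)"
proof -
  have "((\<lambda>y. v y + (1/2) *\<^sub>R n_bracket y (v y)) has_derivative
    (\<lambda>w. v' w + (1/2) *\<^sub>R (n_bracket x (v' w) + n_bracket w (v x)))) (at x)"
    by (intro has_derivative_add has_derivative_scaleR_right n_bracket.FDERIV has_derivative_ident assms)
  then show ?thesis
    by (simp add: left_field_def scaleR_add_right add.assoc)
qed

lemma smooth_map_differentiable: "smooth_map h \<Longrightarrow> (\<lambda>x. h (nil_proj x)) differentiable (at x)"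
  unfolding smooth_map_def using smooth_on_differentiable by blast

text \<open>The frame coefficients of the Lie bracket: derivatives of the coefficients, plus the
  structure constants of the frame.\<close>

definition bracket_coeff :: "(nilmanifold \<Rightarrow> nil_n) \<Rightarrow> (nilmanifold \<Rightarrow> nil_n) \<Rightarrow> nilmanifold \<Rightarrow> nil_n" where
  "bracket_coeff \<xi> \<eta> p = deriv_along \<xi> \<eta> p - deriv_along \<eta> \<xi> p + n_bracket (\<xi> p) (\<eta> p)"

text \<open>Second derivatives of \<open>h\<close> cancel by symmetry, leaving first-order terms
  from the moving directions. Smoothness is asked only on \<open>S\<close>, as Lie brackets act on
  locally smooth functions, and \<open>h\<close> may be vector-valued, as curvature applies the
  identity to coefficients.\<close>

lemma deriv_along_commute:
  fixes h :: "nilmanifold \<Rightarrow> 'b::euclidean_space"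
  assumes \<xi>: "smooth_map \<xi>" and \<eta>: "smooth_map \<eta>"
    and S: "open S" "x \<in> S" and h: "smooth_on S (\<lambda>x. h (nil_proj x))"
  shows "deriv_along \<xi> (deriv_along \<eta> h) (nil_proj x) - deriv_along \<eta> (deriv_along \<xi> h) (nil_proj x)
    = deriv_along (bracket_coeff \<xi> \<eta>) h (nil_proj x)"
proof -
  let ?h = "\<lambda>x. h (nil_proj x)" and ?D = "\<lambda>v y. frechet_derivative (\<lambda>x. h (nil_proj x)) (at y) v"
  let ?F = "\<lambda>\<eta> x. left_field (\<eta> (nil_proj x)) x"
  let ?d = "\<lambda>\<eta>. frechet_derivative (\<lambda>x. \<eta> (nil_proj x)) (at x)"
  have second: "deriv_along \<xi> (deriv_along \<eta> h) (nil_proj x) =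
      frechet_derivative (?D (?F \<eta> x)) (at x) (?F \<xi> x) +
      ?D (left_field (deriv_along \<xi> \<eta> (nil_proj x)) x + (1/2) *\<^sub>R n_bracket (?F \<xi> x) (\<eta> (nil_proj x))) x"
    if "smooth_map \<xi>" "smooth_map \<eta>" for \<xi> \<eta> :: "nilmanifold \<Rightarrow> nil_n"
  proof -
    have "((\<lambda>y. ?D (?F \<eta> y) y) has_derivative
       (\<lambda>v. frechet_derivative (?D (?F \<eta> x)) (at x) v +
          ?D (left_field (?d \<eta> v) x + (1/2) *\<^sub>R n_bracket v (\<eta> (nil_proj x))) x)) (at x)"
      by (intro has_derivative_directional[OF S h] has_derivative_left_field
          has_derivative_frechet smooth_map_differentiable that)
    then have "((\<lambda>y. deriv_along \<eta> h (nil_proj y)) has_derivative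
       (\<lambda>v. frechet_derivative (?D (?F \<eta> x)) (at x) v +
          ?D (left_field (?d \<eta> v) x + (1/2) *\<^sub>R n_bracket v (\<eta> (nil_proj x))) x)) (at x)"
      by (rule has_derivative_transform_within_open[OF _ S])
         (simp add: deriv_along_eq smooth_on_differentiable[OF h])
    from deriv_along_eqI[OF this, of \<xi>] show ?thesis
      by (simp add: deriv_along_eq smooth_map_differentiable that)
  qed
  have sym: "frechet_derivative (?D u) (at x) v = frechet_derivative (?D v) (at x) u" for u v
    using symmetric_second_derivative[OF S] h unfolding smooth_on_def by blast
  have lin: "linear (\<lambda>v. ?D v x)"
    using smooth_on_differentiable[OF h S(2)] by (simp add: linear_frechet_derivative)
  \<comment> \<open>The two half brackets add up to the full bracket of the coefficients by
    skewness; nested brackets vanish.\<close>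
  have "left_field (deriv_along \<xi> \<eta> (nil_proj x)) x + (1/2) *\<^sub>R n_bracket (?F \<xi> x) (\<eta> (nil_proj x))
      - (left_field (deriv_along \<eta> \<xi> (nil_proj x)) x + (1/2) *\<^sub>R n_bracket (?F \<eta> x) (\<xi> (nil_proj x)))
      = ?F (bracket_coeff \<xi> \<eta>) x" (is "?l - ?r = _")
    by (simp add: bracket_coeff_def left_field_def n_bracket_flip[of "\<eta> (nil_proj x)" "\<xi> (nil_proj x)"]
        n_bracket.add_left n_bracket.add_right n_bracket.diff_right n_bracket.scaleR_left algebra_simps)
       (simp flip: scaleR_add_left)
  moreover have "?D ?l x - ?D ?r x = ?D (?l - ?r) x"
    by (rule linear_diff[OF lin, symmetric])
  ultimately show ?thesis
    using smooth_on_differentiable[OF h S(2)]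
    by (simp add: second \<xi> \<eta> sym[of "?F \<eta> x" "?F \<xi> x"] deriv_along_eq)
qed

section \<open>Differential calculus of coefficient functions\<close>

lemma smooth_fun_on_UNIV: "smooth_fun_on nilmanifold_atlas UNIV h \<longleftrightarrow> smooth_map h"
  by (simp add: smooth_fun_on_iff smooth_map_def)

lemma smooth_map_add [intro]: "smooth_map \<xi> \<Longrightarrow> smooth_map \<eta> \<Longrightarrow> smooth_map (\<lambda>p. \<xi> p + \<eta> p)"
  unfolding smooth_map_def by (intro smooth_on_add open_UNIV)

lemma smooth_map_diff [intro]: "smooth_map \<xi> \<Longrightarrow> smooth_map \<eta> \<Longrightarrow> smooth_map (\<lambda>p. \<xi> p - \<eta> p)"
  unfolding smooth_map_def by (intro smooth_on_diff open_UNIV)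

lemma smooth_map_bilinear:
  "bounded_bilinear B \<Longrightarrow> smooth_map \<xi> \<Longrightarrow> smooth_map \<eta> \<Longrightarrow> smooth_map (\<lambda>p. B (\<xi> p) (\<eta> p))"
  unfolding smooth_map_def by (rule smooth_on_bilinear[OF open_UNIV])

lemmas smooth_map_inner [intro] = smooth_map_bilinear[OF bounded_bilinear_inner]
  and smooth_map_n_bracket [intro] = smooth_map_bilinear[OF bounded_bilinear_n_bracket]
  and smooth_map_lc [intro] = smooth_map_bilinear[OF bounded_bilinear_lc]
  and smooth_map_nr [intro] = smooth_map_bilinear[OF bounded_bilinear_nr]

lemma smooth_map_deriv_along [intro]:
  "smooth_map \<xi> \<Longrightarrow> smooth_map \<eta> \<Longrightarrow> smooth_map (deriv_along \<xi> \<eta>)"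
  unfolding smooth_map_def[of \<eta>] smooth_map_def[of "deriv_along \<xi> \<eta>"]
  by (intro smooth_on_deriv_along open_UNIV)

lemma deriv_along_bilinear:
  assumes "bounded_bilinear B" "smooth_map \<eta>" "smooth_map \<zeta>"
  shows "deriv_along \<xi> (\<lambda>p. B (\<eta> p) (\<zeta> p)) p = B (deriv_along \<xi> \<eta> p) (\<zeta> p) + B (\<eta> p) (deriv_along \<xi> \<zeta> p)"
proof -
  obtain x where p: "p = nil_proj x" using nil_proj_surj by blast
  have "((\<lambda>x. B (\<eta> (nil_proj x)) (\<zeta> (nil_proj x))) has_derivative
     (\<lambda>v. B (\<eta> (nil_proj x)) (frechet_derivative (\<lambda>x. \<zeta> (nil_proj x)) (at x) v) +
        B (frechet_derivative (\<lambda>x. \<eta> (nil_proj x)) (at x) v) (\<zeta> (nil_proj x)))) (at x)"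
    by (intro bounded_bilinear.FDERIV[OF assms(1)] has_derivative_frechet smooth_map_differentiable assms)
  from deriv_along_eqI[OF this, of \<xi>] show ?thesis
    by (simp add: p deriv_along_eq smooth_map_differentiable assms)
qed

lemma deriv_along_add:
  assumes "smooth_map \<eta>" "smooth_map \<zeta>"
  shows "deriv_along \<xi> (\<lambda>p. \<eta> p + \<zeta> p) p = deriv_along \<xi> \<eta> p + deriv_along \<xi> \<zeta> p"
proof -
  obtain x where p: "p = nil_proj x" using nil_proj_surj by blast
  have "((\<lambda>x. \<eta> (nil_proj x) + \<zeta> (nil_proj x)) has_derivative
     (\<lambda>v. frechet_derivative (\<lambda>x. \<eta> (nil_proj x)) (at x) v +
        frechet_derivative (\<lambda>x. \<zeta> (nil_proj x)) (at x) v)) (at x)"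
    by (intro has_derivative_add has_derivative_frechet smooth_map_differentiable assms)
  from deriv_along_eqI[OF this, of \<xi>] show ?thesis
    by (simp add: p deriv_along_eq smooth_map_differentiable assms)
qed

lemma deriv_along_diff:
  assumes "smooth_map \<eta>" "smooth_map \<zeta>"
  shows "deriv_along \<xi> (\<lambda>p. \<eta> p - \<zeta> p) p = deriv_along \<xi> \<eta> p - deriv_along \<xi> \<zeta> p"
  using deriv_along_add[OF smooth_map_diff[OF assms] assms(2), of \<xi> p] by simp

lemma deriv_along_direction:
  assumes "smooth_map h"
  shows "deriv_along (\<lambda>p. \<xi> p + \<eta> p) h p = deriv_along \<xi> h p + deriv_along \<eta> h p"
    and "deriv_along (\<lambda>p. c p *\<^sub>R \<xi> p) h p = c p *\<^sub>R deriv_along \<xi> h p"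
proof -
  obtain x where p: "p = nil_proj x" using nil_proj_surj by blast
  have d: "(\<lambda>x. h (nil_proj x)) differentiable (at x)"
    by (rule smooth_map_differentiable[OF assms])
  show "deriv_along (\<lambda>p. \<xi> p + \<eta> p) h p = deriv_along \<xi> h p + deriv_along \<eta> h p"
    and "deriv_along (\<lambda>p. c p *\<^sub>R \<xi> p) h p = c p *\<^sub>R deriv_along \<xi> h p"
    by (simp_all add: p deriv_along_eq[OF d] left_field_add left_field_scaleR
        linear_add[OF linear_frechet_derivative[OF d]] linear_cmul[OF linear_frechet_derivative[OF d]])
qed

lemmas deriv_along_simps = deriv_along_add deriv_along_diff deriv_along_direction
  deriv_along_bilinear[OF bounded_bilinear_scaleR] deriv_along_bilinear[OF bounded_bilinear_inner]
  deriv_along_bilinear[OF bounded_bilinear_lc] deriv_along_bilinear[OF bounded_bilinear_nr]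
  deriv_along_bilinear[OF bounded_bilinear_n_bracket]

lemma deriv_along_bracket:
  fixes \<zeta> :: "nilmanifold \<Rightarrow> 'b::euclidean_space"
  assumes "smooth_map \<xi>" "smooth_map \<eta>" "smooth_map \<zeta>"
  shows "deriv_along (bracket_coeff \<xi> \<eta>) \<zeta> p =
    deriv_along \<xi> (deriv_along \<eta> \<zeta>) p - deriv_along \<eta> (deriv_along \<xi> \<zeta>) p"
proof -
  obtain x where "p = nil_proj x" using nil_proj_surj by blast
  then show ?thesis
    using deriv_along_commute[OF assms(1,2) open_UNIV UNIV_I assms(3)[unfolded smooth_map_def], of x] by simp
qed

lemma deriv_along_lc_curvature:
  assumes "smooth_map \<xi>" "smooth_map \<eta>" "smooth_map \<zeta>"
  shows "deriv_along \<nu> (\<lambda>p. lc_curvature (\<xi> p) (\<eta> p) (\<zeta> p)) p =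
    lc_curvature (deriv_along \<nu> \<xi> p) (\<eta> p) (\<zeta> p) + lc_curvature (\<xi> p) (deriv_along \<nu> \<eta> p) (\<zeta> p)
    + lc_curvature (\<xi> p) (\<eta> p) (deriv_along \<nu> \<zeta> p)"
  using assms
  by (simp add: lc_curvature_def deriv_along_simps smooth_map_diff smooth_map_lc smooth_map_n_bracket)
     (simp add: lc.add_left lc.add_right algebra_simps)

section \<open>Operations on vector fields in terms of coefficients\<close>

lemma field_add: "field \<xi> + field \<eta> = field (\<lambda>p. \<xi> p + \<eta> p)"
  using frame_linear[of _ 1 _ 1] by (simp add: fun_eq_iff field_def)

lemma field_diff: "field \<xi> - field \<eta> = field (\<lambda>p. \<xi> p - \<eta> p)"
  using frame_linear[of _ 1 _ "-1"] by (simp add: fun_eq_iff field_def)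

lemma fun_scale_field: "fun_scale h (field \<xi>) = field (\<lambda>p. h p *\<^sub>R \<xi> p)"
  using frame_linear[of _ _ _ 0] by (simp add: fun_eq_iff field_def fun_scale_def)

lemma field_0: "field (\<lambda>p. 0) = 0"
  using frame_linear[of _ 0 _ 0] by (simp add: fun_eq_iff field_def)

lemma field_smooth_map: "smooth_map h \<Longrightarrow> field \<xi> p h = deriv_along \<xi> h p"
  using smooth_near_open[OF open_UNIV UNIV_I] by (simp add: field_eq smooth_fun_on_UNIV)

lemma lie_bracket_field:
  assumes \<xi>: "smooth_map \<xi>" and \<eta>: "smooth_map \<eta>"
  shows "lie_bracket nilmanifold_atlas (field \<xi>) (field \<eta>) = field (bracket_coeff \<xi> \<eta>)"
proof (intro ext)
  fix p :: nilmanifold and f :: "nilmanifold \<Rightarrow> real"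
  obtain x where p: "p = nil_proj x" using nil_proj_surj by blast
  show "lie_bracket nilmanifold_atlas (field \<xi>) (field \<eta>) p f = field (bracket_coeff \<xi> \<eta>) p f"
  proof (cases "smooth_near nilmanifold_atlas p f")
    case True
    then obtain W where W: "open W" "p \<in> W" "smooth_fun_on nilmanifold_atlas W f"
      by (auto simp: smooth_near_def)
    have op: "open (nil_proj -` W)" and x: "x \<in> nil_proj -` W"
      using W(1,2) open_nil_proj_vimage p by blast+
    have f: "smooth_on (nil_proj -` W) (\<lambda>x. f (nil_proj x))"
      using W by (simp add: smooth_fun_on_iff)
    have iter: "field \<xi> p (\<lambda>q. field \<eta> q f) = deriv_along \<xi> (deriv_along \<eta> f) p"
      if "smooth_map \<xi>" "smooth_map \<eta>" for \<xi> \<eta>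
    proof -
      have "field \<eta> \<in> vector_fields nilmanifold_atlas"
        using that by (simp add: vector_fields_nilmanifold)
      then have "smooth_near nilmanifold_atlas p (\<lambda>q. field \<eta> q f)"
        using W unfolding vector_fields_def smooth_near_def by blast
      then have "field \<xi> p (\<lambda>q. field \<eta> q f) = deriv_along \<xi> (\<lambda>q. field \<eta> q f) p"
        by (simp add: field_eq)
      \<comment> \<open>Where \<open>f\<close> is not locally smooth,
        \<open>field \<eta> q f\<close> takes the default 0, so the two inner functions are known to
        agree only on \<open>W\<close>; this suffices for equal derivatives at
        \<open>p\<close>.\<close>
      also have "\<dots> = deriv_along \<xi> (deriv_along \<eta> f) p"
      proof -
        have D: "((\<lambda>x. deriv_along \<eta> f (nil_proj x)) has_derivative
            frechet_derivative (\<lambda>x. deriv_along \<eta> f (nil_proj x)) (at x)) (at x)"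
          by (intro has_derivative_frechet smooth_on_differentiable[OF smooth_on_deriv_along[OF that(2) op f] x])
        then have "((\<lambda>x. field \<eta> (nil_proj x) f) has_derivative
            frechet_derivative (\<lambda>x. deriv_along \<eta> f (nil_proj x)) (at x)) (at x)"
          by (rule has_derivative_transform_within_open[OF _ op x])
             (use W smooth_near_open in \<open>simp add: field_eq\<close>)
        from deriv_along_eqI[OF this] deriv_along_eqI[OF D] show ?thesis
          by (simp add: p)
      qed
      finally show ?thesis .
    qed
    then have "lie_bracket nilmanifold_atlas (field \<xi>) (field \<eta>) p f =
        deriv_along \<xi> (deriv_along \<eta> f) p - deriv_along \<eta> (deriv_along \<xi> f) p"
      using True \<xi> \<eta> by (simp add: lie_bracket_def)
    also have "\<dots> = field (bracket_coeff \<xi> \<eta>) p f"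
      using True deriv_along_commute[OF \<xi> \<eta> op x f] by (simp add: field_eq p)
    finally show ?thesis .
  qed (simp add: lie_bracket_def field_eq)
qed

section \<open>The metric\<close>

lemma comp_inv_ident: "f \<circ> inv_into UNIV (\<lambda>x. x) = f"
  using inv_id by (simp add: o_def id_def)

lemma smooth_near_nil_atlas:
  "smooth_near nil_atlas x f \<longleftrightarrow> (\<exists>W. open W \<and> x \<in> W \<and> smooth_on W f)"
  unfolding smooth_near_def smooth_fun_on_def nil_atlas_def by (simp add: comp_inv_ident del: inv_identity)

lemma nil_vec_eq:
  "nil_vec x v = (\<lambda>f. if smooth_near nil_atlas x f then frechet_derivative f (at x) v else 0)"
  unfolding nil_vec_def coord_vector_def prod.case comp_inv_ident ..

lemma tangent_space_nil_atlas: "tangent_space nil_atlas x = range (nil_vec x)"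
  by (auto simp: tangent_space_def nil_atlas_def nil_vec_def)

lemma nil_vec_inject: "nil_vec x v = nil_vec x w \<longleftrightarrow> v = w"
proof
  assume eq: "nil_vec x v = nil_vec x w"
  have "v \<bullet> b = w \<bullet> b" for b
  proof -
    have "smooth_near nil_atlas x (\<lambda>y. y \<bullet> b)"
      unfolding smooth_near_nil_atlas
      using smooth_on_bounded_linear[OF bounded_linear_inner_left] by blast
    moreover have "frechet_derivative (\<lambda>y. y \<bullet> b) (at x) = (\<lambda>v. v \<bullet> b)"
      by (rule frechet_derivative_eqI[OF bounded_linear_imp_has_derivative[OF bounded_linear_inner_left]])
    ultimately show ?thesis
      using fun_cong[OF eq, of "\<lambda>y. y \<bullet> b"] by (simp add: nil_vec_eq)
  qed
  then show "v = w"
    by (metis vector_eq_rdot)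
qed simp

lemma differential_nil_proj:
  "differential nilmanifold_atlas nil_proj x (nil_vec x v) = frame (nil_proj x) (coframe x v)"
proof
  fix f :: "nilmanifold \<Rightarrow> real"
  have "smooth_near nil_atlas x (f \<circ> nil_proj)" if "smooth_near nilmanifold_atlas (nil_proj x) f"
    using that open_nil_proj_vimage unfolding smooth_near_iff smooth_near_nil_atlas o_def by blast
  then show "differential nilmanifold_atlas nil_proj x (nil_vec x v) f = frame (nil_proj x) (coframe x v) f"
    by (simp add: differential_def nil_vec_eq frame_def deriv_along_eq smooth_near_differentiable o_def)
qed

lemma differential_translation:
  "differential nil_atlas (translation a) x (nil_vec x v) = nil_vec (translation a x) (left_field v a)"
proof
  fix f :: "nil_n \<Rightarrow> real"
  show "differential nil_atlas (translation a) x (nil_vec x v) f = nil_vec (translation a x) (left_field v a) f"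
  proof (cases "smooth_near nil_atlas (translation a x) f")
    case True
    then obtain W where W: "open W" "translation a x \<in> W" "smooth_on W f"
      by (auto simp: smooth_near_nil_atlas)
    have "smooth_on (translation a -` W) (f \<circ> translation a)"
      using smooth_on_translation_compose[OF W(1,3)] by (simp add: o_def)
    moreover have "open (translation a -` W)"
      using W(1) by (intro open_vimage continuous_intros)
    ultimately have near: "smooth_near nil_atlas x (f \<circ> translation a)"
      using W(2) unfolding smooth_near_nil_atlas by blast
    have "((f \<circ> translation a) has_derivative
        (\<lambda>v. frechet_derivative f (at (translation a x)) (left_field v a))) (at x)"
      unfolding o_def
      by (rule has_derivative_compose[OF has_derivative_translation])
         (rule has_derivative_frechet[OF smooth_on_differentiable[OF W(3,2)]])
    then show ?thesis
      using True near by (simp add: differential_def nil_vec_eq frechet_derivative_eqI)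
  qed (simp add: differential_def nil_vec_eq)
qed

text \<open>Translating back by the inverse of \<open>x\<close> carries the left-invariant field to
  its value at the identity.\<close>

lemma left_invariant_metric_nil_vec:
  "left_invariant_metric x (nil_vec x (left_field v x)) (nil_vec x (left_field w x)) = v \<bullet> w"
proof -
  have "the_inv (nil_vec 0) (differential nil_atlas (\<lambda>y. inv\<^bsub>nil_group\<^esub> x \<otimes>\<^bsub>nil_group\<^esub> y) x
      (nil_vec x (left_field v x))) = v" for v
    using the_inv_f_f[of "nil_vec 0" v]
    by (simp add: inv_nil_group differential_translation left_field_translation inj_def nil_vec_inject)
  then show ?thesis
    by (simp add: left_invariant_metric_def)
qed

text \<open>Whichever point \<open>x\<close> of the fibre is chosen, a frame vector lifts to the
  left-invariant vector with the same coefficient, so the choice leaves no trace.\<close>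

lemma nilmanifold_metric_frame: "nilmanifold_metric p (frame p v) (frame p w) = v \<bullet> w"
proof -
  define x where "x = (SOME x. nil_proj x = p)"
  have p: "p = nil_proj x"
    unfolding x_def by (simp add: nil_proj_some)
  have "inj_on (differential nilmanifold_atlas nil_proj x) (tangent_space nil_atlas x)"
    unfolding tangent_space_nil_atlas
    by (rule inj_onI) (metis (no_types, lifting) differential_nil_proj frame_inject left_field_coframe rangeE)
  from the_inv_into_f_f[OF this, of "nil_vec x (left_field v x)" for v]
  have "the_inv_into (tangent_space nil_atlas x) (differential nilmanifold_atlas nil_proj x) (frame p v)
      = nil_vec x (left_field v x)" for v
    by (simp add: tangent_space_nil_atlas differential_nil_proj p)
  then show ?thesis
    by (simp add: nilmanifold_metric_def Let_def left_invariant_metric_nil_vec flip: x_def)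
qed

lemma nilmanifold_metric_field: "nilmanifold_metric p (field \<xi> p) (field \<eta> p) = \<xi> p \<bullet> \<eta> p"
  by (simp add: field_def nilmanifold_metric_frame)

lemma riemannian_nilmanifold: "riemannian_manifold nilmanifold_atlas nilmanifold_metric"
  unfolding riemannian_manifold_def
proof (intro conjI smooth_manifold_nilmanifold allI ballI impI)
  fix p u v assume "u \<in> tangent_space nilmanifold_atlas p" "v \<in> tangent_space nilmanifold_atlas p"
  then obtain a b where uv: "u = frame p a" "v = frame p b"
    by (auto simp: tangent_space_nilmanifold)
  show "nilmanifold_metric p u v = nilmanifold_metric p v u"
    by (simp add: uv nilmanifold_metric_frame inner_commute)
  show "0 < nilmanifold_metric p u u" if "u \<noteq> 0"
  proof -
    have "a \<noteq> 0"
      \<comment> \<open>Linearity with zero scalars shows that \<open>frame p 0\<close> is the zero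
        functional.\<close>
      using that frame_linear[of p 0 0 0 0] by (auto simp: uv fun_eq_iff)
    then show ?thesis
      by (simp add: uv nilmanifold_metric_frame)
  qed
  fix w s t assume "w \<in> tangent_space nilmanifold_atlas p"
  then obtain c where w: "w = frame p c"
    by (auto simp: tangent_space_nilmanifold)
  show "nilmanifold_metric p (\<lambda>f. s * u f + t * v f) w = s * nilmanifold_metric p u w + t * nilmanifold_metric p v w"
    unfolding uv w frame_linear[symmetric] nilmanifold_metric_frame by (simp add: inner_add_left)
next
  fix X Y assume "X \<in> vector_fields nilmanifold_atlas" "Y \<in> vector_fields nilmanifold_atlas"
  then show "smooth_fun_on nilmanifold_atlas UNIV (\<lambda>p. nilmanifold_metric p (X p) (Y p))"
    by (auto simp: vector_fields_nilmanifold nilmanifold_metric_field smooth_fun_on_UNIV)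
qed

section \<open>The Levi-Civita connection and the homogeneous structure\<close>

definition connection :: "nilmanifold connection" where
  "connection X Y = field (\<lambda>p. deriv_along (\<lambda>q. coeff q (X q)) (\<lambda>q. coeff q (Y q)) p
     + lc (coeff p (X p)) (coeff p (Y p)))"

lemma connection_field: "connection (field \<xi>) (field \<eta>) = field (\<lambda>p. deriv_along \<xi> \<eta> p + lc (\<xi> p) (\<eta> p))"
  by (simp add: connection_def)

lemma affine_connection_connection: "affine_connection nilmanifold_atlas connection"
  unfolding affine_connection_def vector_fields_nilmanifold ball_simps(9)
  by (auto simp: connection_field field_add fun_scale_field smooth_fun_on_UNIV deriv_along_simps
      field_smooth_map lc.add_left lc.add_right lc.scaleR_left lc.scaleR_right algebra_simps
      intro!: imageI)

text \<open>In the frame the metric is a constant inner product, so the derivative parts are settled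
  by \<open>bracket_coeff\<close> and the Leibniz rule; \<open>lc_torsion_free\<close> and
  \<open>lc_metric\<close> settle the rest.\<close>

lemma levi_civita_connection: "levi_civita nilmanifold_atlas nilmanifold_metric connection"
  unfolding levi_civita_def vector_fields_nilmanifold ball_simps(9)
proof (intro conjI ballI allI affine_connection_connection, unfold mem_Collect_eq)
  fix \<xi> \<eta> :: "nilmanifold \<Rightarrow> nil_n" assume sm: "smooth_map \<xi>" "smooth_map \<eta>"
  have "deriv_along \<xi> \<eta> p + lc (\<xi> p) (\<eta> p) - (deriv_along \<eta> \<xi> p + lc (\<eta> p) (\<xi> p)) = bracket_coeff \<xi> \<eta> p" for p
    using lc_torsion_free[of "\<xi> p" "\<eta> p"] by (simp add: bracket_coeff_def algebra_simps)
  then show "connection (field \<xi>) (field \<eta>) - connection (field \<eta>) (field \<xi>)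
      = lie_bracket nilmanifold_atlas (field \<xi>) (field \<eta>)"
    by (simp add: connection_field field_diff lie_bracket_field sm)
  fix \<zeta> :: "nilmanifold \<Rightarrow> nil_n" and p assume "smooth_map \<zeta>"
  then show "field \<xi> p (\<lambda>q. nilmanifold_metric q (field \<eta> q) (field \<zeta> q)) =
      nilmanifold_metric p (connection (field \<xi>) (field \<eta>) p) (field \<zeta> p) +
      nilmanifold_metric p (field \<eta> p) (connection (field \<xi>) (field \<zeta>) p)"
    using sm lc_metric[of "\<xi> p" "\<eta> p" "\<zeta> p"]
    by (simp add: nilmanifold_metric_field connection_field field_smooth_map smooth_map_inner
        deriv_along_simps inner_add_left inner_add_right)
qed

text \<open>\<open>deriv_along_bracket\<close> cancels the second derivatives of
  \<open>\<zeta>\<close>, and the Leibniz rule for \<open>lc\<close> cancels the first derivatives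
  of all coefficients.\<close>

lemma curvature_field:
  assumes "smooth_map \<xi>" "smooth_map \<eta>" "smooth_map \<zeta>"
  shows "curvature nilmanifold_atlas connection (field \<xi>) (field \<eta>) (field \<zeta>) =
    field (\<lambda>p. lc_curvature (\<xi> p) (\<eta> p) (\<zeta> p))"
  using assms
  by (simp add: curvature_def connection_field lie_bracket_field field_diff deriv_along_simps
      deriv_along_bracket smooth_map_deriv_along smooth_map_lc)
     (simp add: bracket_coeff_def lc_curvature_def lc.add_left lc.add_right lc.diff_left algebra_simps)

definition nr_tensor :: "nilmanifold tensor21" where
  "nr_tensor p u v = frame p (nr (coeff p u) (coeff p v))"

lemma tapply_nr_tensor: "tapply nr_tensor (field \<xi>) (field \<eta>) = field (\<lambda>p. nr (\<xi> p) (\<eta> p))"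
  by (simp add: tapply_def nr_tensor_def) (simp add: field_def)

lemma tensor_field_nr_tensor: "tensor_field21 nilmanifold_atlas nr_tensor"
  unfolding tensor_field21_def
proof (intro conjI allI ballI)
  fix p u v assume "u \<in> tangent_space nilmanifold_atlas p" "v \<in> tangent_space nilmanifold_atlas p"
  then obtain a b where uv: "u = frame p a" "v = frame p b"
    by (auto simp: tangent_space_nilmanifold)
  show "nr_tensor p u v \<in> tangent_space nilmanifold_atlas p"
    by (simp add: nr_tensor_def tangent_space_nilmanifold)
  fix w s t assume "w \<in> tangent_space nilmanifold_atlas p"
  then obtain c where w: "w = frame p c"
    by (auto simp: tangent_space_nilmanifold)
  show "nr_tensor p (\<lambda>f. s * u f + t * v f) w = (\<lambda>f. s * nr_tensor p u w f + t * nr_tensor p v w f)"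
    and "nr_tensor p w (\<lambda>f. s * u f + t * v f) = (\<lambda>f. s * nr_tensor p w u f + t * nr_tensor p w v f)"
    unfolding uv w frame_linear[symmetric] nr_tensor_def coeff_frame
    by (simp_all add: nr.add_left nr.add_right nr.scaleR_left nr.scaleR_right)
next
  fix X Y assume "X \<in> vector_fields nilmanifold_atlas" "Y \<in> vector_fields nilmanifold_atlas"
  then show "tapply nr_tensor X Y \<in> vector_fields nilmanifold_atlas"
    by (auto simp: vector_fields_nilmanifold tapply_nr_tensor)
qed

lemma homogeneous_structure_nr_tensor:
  "homogeneous_structure nilmanifold_atlas nilmanifold_metric nr_tensor"
  unfolding homogeneous_structure_def vector_fields_nilmanifold ball_simps(9)
proof (intro conjI ballI allI tensor_field_nr_tensor exI[of _ connection] levi_civita_connection,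
    unfold mem_Collect_eq)
  fix \<nu> \<xi> \<eta> \<zeta> :: "nilmanifold \<Rightarrow> nil_n"
  assume sm: "smooth_map \<nu>" "smooth_map \<xi>" "smooth_map \<eta>" "smooth_map \<zeta>"
  have cov: "smooth_map (\<lambda>p. deriv_along \<nu> \<xi> p + lc (\<nu> p) (\<xi> p))"
    if "smooth_map \<nu>" "smooth_map \<xi>" for \<nu> \<xi>
    using that by auto
  have *: "lc_curvature (x + x') y z = lc_curvature x y z + lc_curvature x' y z"
    "lc_curvature x (y + y') z = lc_curvature x y z + lc_curvature x y' z"
    "lc_curvature x y (z + z') = lc_curvature x y z + lc_curvature x y z'" for x x' y y' z z'
    by (simp_all add: lc_curvature_def lc.add_left lc.add_right n_bracket.add_left n_bracket.add_right)
  \<comment> \<open>By additivity in each slot the derivatives of coefficients cancel against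
    \<open>deriv_along_lc_curvature\<close>; what remains is
    \<open>lc_curvature_parallel\<close>.\<close>
  have "deriv_along \<nu> (\<lambda>p. lc_curvature (\<xi> p) (\<eta> p) (\<zeta> p)) p + lc (\<nu> p) (lc_curvature (\<xi> p) (\<eta> p) (\<zeta> p))
      - lc_curvature (deriv_along \<nu> \<xi> p + lc (\<nu> p) (\<xi> p)) (\<eta> p) (\<zeta> p)
      - lc_curvature (\<xi> p) (deriv_along \<nu> \<eta> p + lc (\<nu> p) (\<eta> p)) (\<zeta> p)
      - lc_curvature (\<xi> p) (\<eta> p) (deriv_along \<nu> \<zeta> p + lc (\<nu> p) (\<zeta> p)) =
    nr (\<nu> p) (lc_curvature (\<xi> p) (\<eta> p) (\<zeta> p)) - lc_curvature (nr (\<nu> p) (\<xi> p)) (\<eta> p) (\<zeta> p)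
      - lc_curvature (\<xi> p) (nr (\<nu> p) (\<eta> p)) (\<zeta> p) - lc_curvature (\<xi> p) (\<eta> p) (nr (\<nu> p) (\<zeta> p))" for p
    using lc_curvature_parallel[of "\<nu> p" "\<xi> p" "\<eta> p" "\<zeta> p"] sm
    by (simp add: deriv_along_lc_curvature * algebra_simps)
  then show "nabla_curvature nilmanifold_atlas connection (field \<nu>) (field \<xi>) (field \<eta>) (field \<zeta>) =
      tapply nr_tensor (field \<nu>) (curvature nilmanifold_atlas connection (field \<xi>) (field \<eta>) (field \<zeta>))
      - curvature nilmanifold_atlas connection (tapply nr_tensor (field \<nu>) (field \<xi>)) (field \<eta>) (field \<zeta>)
      - curvature nilmanifold_atlas connection (field \<xi>) (tapply nr_tensor (field \<nu>) (field \<eta>)) (field \<zeta>)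
      - curvature nilmanifold_atlas connection (field \<xi>) (field \<eta>) (tapply nr_tensor (field \<nu>) (field \<zeta>))"
    by (simp add: nabla_curvature_def curvature_field connection_field tapply_nr_tensor field_diff sm cov smooth_map_nr)
  have "deriv_along \<xi> (\<lambda>p. nr (\<eta> p) (\<zeta> p)) p + lc (\<xi> p) (nr (\<eta> p) (\<zeta> p))
      - nr (deriv_along \<xi> \<eta> p + lc (\<xi> p) (\<eta> p)) (\<zeta> p) - nr (\<eta> p) (deriv_along \<xi> \<zeta> p + lc (\<xi> p) (\<zeta> p)) =
    nr (\<xi> p) (nr (\<eta> p) (\<zeta> p)) - nr (\<eta> p) (nr (\<xi> p) (\<zeta> p)) - nr (nr (\<xi> p) (\<eta> p)) (\<zeta> p)" for p
    using lc_nr_parallel[of "\<xi> p" "\<eta> p" "\<zeta> p"] sm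
    by (simp add: deriv_along_simps nr.add_left nr.add_right algebra_simps)
  then show "nabla_tensor connection nr_tensor (field \<xi>) (field \<eta>) (field \<zeta>) =
      tapply nr_tensor (field \<xi>) (tapply nr_tensor (field \<eta>) (field \<zeta>))
      - tapply nr_tensor (field \<eta>) (tapply nr_tensor (field \<xi>) (field \<zeta>))
      - tapply nr_tensor (tapply nr_tensor (field \<xi>) (field \<eta>)) (field \<zeta>)"
    by (simp add: nabla_tensor_def connection_field tapply_nr_tensor field_diff)
  show "nilmanifold_metric p (tapply nr_tensor (field \<xi>) (field \<eta>) p) (field \<zeta> p) +
      nilmanifold_metric p (field \<eta> p) (tapply nr_tensor (field \<xi>) (field \<zeta>) p) = 0" for p
    by (simp add: tapply_nr_tensor nilmanifold_metric_field nr_metric)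
qed

theorem proposition3p2:
  shows "compact (UNIV :: nilmanifold set) \<and>
    riemannian_manifold nilmanifold_atlas nilmanifold_metric \<and>
    naturally_reductive nilmanifold_atlas nilmanifold_metric"
proof (intro conjI compact_nilmanifold riemannian_nilmanifold)
  show "naturally_reductive nilmanifold_atlas nilmanifold_metric"
    unfolding naturally_reductive_def vector_fields_nilmanifold
    by (intro exI[of _ nr_tensor] conjI homogeneous_structure_nr_tensor)
       (auto simp: tapply_nr_tensor nr_self field_0)
qed

end
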